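(* Let $G=\mathbb Z^n$ (with a total group ordering), let $k$ be a field and $K\subseteq k((G))$ a Hahn field with the first lifting property and the canonical second lifting property. Then \begin{align*} v\text{-}\mathrm{Aut}\,K&\simeq(1\text{-}\mathrm{Aut}\,K\rtimes(k^\times)^n)\rtimes(\mathrm{Aut}\,k\times o\text{-}\mathrm{Aut}\,G),\\ v\text{-}\mathrm{Aut}_kK&\simeq(1\text{-}\mathrm{Aut}_kK\rtimes(k^\times)^n)\rtimes o\text{-}\mathrm{Aut}\,G. \end{align*} If, moreover, $K$ satisfies the canonical first lifting property, then \[ v\text{-}\mathrm{Aut}_{(k)}K\simeq(1\text{-}\mathrm{Aut}_kK\rtimes(k^\times)^n)\rtimes(\mathrm{Aut}\,k\times o\text{-}\mathrm{Aut}\,G). \]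
   Context: $k$ is a field and $(G,+,<)$ a totally ordered abelian group. $\mathbb K=k((G))$ is the field of all formal series $a=\sum_{g\in G}a_gt^g$ ($a_g\in k$) whose support $\operatorname{supp}a=\{g:a_g\neq 0\}$ is well ordered, with termwise addition and convolution product. $k(G)\subseteq\mathbb K$ is the fraction field of the group ring $k[G]$ (series with finite support). A Hahn field is a field $K$ with $k(G)\subseteq K\subseteq \mathbb K$. It carries the valuation $v(a)=\min\operatorname{supp}a$ for $a\neq0$, $v(0)=\infty$, with value group $G$. $\mathrm{Aut}\,k$ is the group of field automorphisms of $k$; $o\text{-}\mathrm{Aut}\,G$ is the group of order preserving automorphisms of $G$. $v\text{-}\mathrm{Aut}\,K$ is the group of valuation preserving automorphisms: field automorphisms $\sigma$ of $K$ for which there is $\tau\in o\text{-}\mathrm{Aut}\,G$ with $\tau(v(a))=v(\sigma(a))$ for all $a\in K^\times$. For any group of automorphisms of $K$, the subscript $(k)$ denotes the subgroup of those $\sigma$ with $\sigma(k)=k$, the subscript $k$ the subgroup of those with $\sigma|_k=\mathrm{id}_k$. For $\sigma\in v\text{-}\mathrm{Aut}\,K$ let $\sigma_G\in o\text{-}\mathrm{Aut}\,G$, $\sigma_G(v(a))=v(\sigma(a))$, and $\sigma_k\in\mathrm{Aut}\,k$, $\sigma_k(c)=\sigma(c)_0$ (constant term) for $c\in k$. This gives a group homomorphism $\Phi\colon v\text{-}\mathrm{Aut}\,K\to\mathrm{Aut}\,k\times o\text{-}\mathrm{Aut}\,G$, $\sigma\mapsto(\sigma_k,\sigma_G)$.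 Put $\mathrm{IntAut}\,K:=\ker\Phi$. $K$ has the first lifting property if there is an injective group homomorphism $\Psi\colon \mathrm{Aut}\,k\times o\text{-}\mathrm{Aut}\,G\to v\text{-}\mathrm{Aut}\,K$ with $\Phi\Psi=\mathrm{id}$; such a $\Psi$ is fixed and $\mathrm{ExtAut}\,K:=\operatorname{im}\Psi$. $K$ has the canonical first lifting property if for all $(\rho,\tau)\in\mathrm{Aut}\,k\times o\text{-}\mathrm{Aut}\,G$ the automorphism $\widetilde{\rho\tau}\colon\sum a_gt^g\mapsto\sum\rho(a_g)t^{\tau(g)}$ of $\mathbb K$ satisfies $\widetilde{\rho\tau}(K)=K$; in that case the section is always chosen to be $\Psi_c\colon(\rho,\tau)\mapsto\widetilde{\rho\tau}|_K$. $\mathrm{Hom}(G,k^\times)$ is the group, under pointwise multiplication, of homomorphisms $x\colon(G,+)\to(k^\times,\cdot)$, $x^g:=x(g)$; for $G=\mathbb Z^n$ it is isomorphic to $(k^\times)^n$. $K$ has the canonical second lifting property if $x\mapsto\rho_x$, $\rho_x(\sum a_gt^g)=\sum a_gx^gt^g$, is a well defined group homomorphism $\mathrm{Hom}(G,k^\times)\to\mathrm{IntAut}\,K$. The group of 1-automorphisms is $1\text{-}\mathrm{Aut}\,K:=\{\sigma\in\mathrm{IntAut}\,K:\sigma(t^g)_g=1\text{ for all }g\in G\}$. Semi-direct products are written with the normal factor on the left; the actions are induced by conjugation of automorphisms via the identifications $(k^\times)^n\simeq\mathrm{Hom}(G,k^\times)$, $x\mapsto\rho_x$, and $\mathrm{ExtAut}\,K\simeq\mathrm{Aut}\,k\times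 o\text{-}\mathrm{Aut}\,G$ (respectively $\mathrm{ExtAut}_kK\simeq o\text{-}\mathrm{Aut}\,G$).
   Formalization: The second formula, for a general section Ψ, assumes that τ ↦ Ψ(id,τ) is an isomorphism from o-Aut G onto ExtAut_k K; this can fail, and then the product is undefined. Under the canonical first lifting property it is proved for Ψ_c without this assumption. *)

theory Defs
  imports "HOL-Algebra.Algebra" "HOL-Analysis.Finite_Cartesian_Product"
begin

section \<open>Ordered groups, Hahn series, Hahn fields\<close>

(* The order is an explicit strict relation, because the type int ^ 'n used for Z^n already
   carries the componentwise partial order as its class instance. *)
definition group_ordering :: "('g::ab_group_add \<Rightarrow> 'g \<Rightarrow> bool) \<Rightarrow> bool" where
  "group_ordering lt \<longleftrightarrow>
     irreflp lt \<and> transp lt \<and> totalp lt \<and> (\<forall>a b c. lt a b \<longrightarrow> lt (a + c) (b + c))"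

definition supp :: "('g \<Rightarrow> 'k::zero) \<Rightarrow> 'g set" where
  "supp a = {g. a g \<noteq> 0}"

(* The series sum_g a_g t^g is its coefficient function a. As lt is total, well-foundedness
   on the support is well-orderedness. The index set of the convolution is finite for series
   with well-ordered support. *)
definition hahn_series :: "('g::ab_group_add \<Rightarrow> 'g \<Rightarrow> bool) \<Rightarrow> ('g \<Rightarrow> 'k::field) ring" where
  "hahn_series lt =
     \<lparr>carrier = {a. wfp_on (supp a) lt},
      monoid.mult = (\<lambda>a b g. \<Sum>h\<in>{h. h \<in> supp a \<and> g - h \<in> supp b}. a h * b (g - h)),
      monoid.one = (\<lambda>g. if g = 0 then 1 else 0),
      ring.zero = (\<lambda>g. 0),
      ring.add = (\<lambda>a b g. a g + b g)\<rparr>"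

definition hahn_const :: "'k::zero \<Rightarrow> ('g::zero \<Rightarrow> 'k)" where
  "hahn_const c = (\<lambda>g. if g = 0 then c else 0)"

definition hahn_monomial :: "'g \<Rightarrow> ('g \<Rightarrow> 'k::zero_neq_one)" where
  "hahn_monomial g = (\<lambda>h. if h = g then 1 else 0)"

definition group_ring :: "('g \<Rightarrow> 'k::zero) set" where
  "group_ring = {a. finite (supp a)}"

definition group_ring_fractions :: "('g::ab_group_add \<Rightarrow> 'g \<Rightarrow> bool) \<Rightarrow> ('g \<Rightarrow> 'k::field) set" where
  "group_ring_fractions lt =
     {a \<otimes>\<^bsub>hahn_series lt\<^esub> inv\<^bsub>hahn_series lt\<^esub> b | a b.
        a \<in> group_ring \<and> b \<in> group_ring \<and> b \<noteq> \<zero>\<^bsub>hahn_series lt\<^esub>}"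

definition hahn_field :: "('g::ab_group_add \<Rightarrow> 'g \<Rightarrow> bool) \<Rightarrow> ('g \<Rightarrow> 'k::field) set \<Rightarrow> bool" where
  "hahn_field lt K \<longleftrightarrow> subfield K (hahn_series lt) \<and> group_ring_fractions lt \<subseteq> K"

(* Meaningful for nonzero series only; the value at 0 is never used. *)
definition val :: "('g \<Rightarrow> 'g \<Rightarrow> bool) \<Rightarrow> ('g \<Rightarrow> 'k::zero) \<Rightarrow> 'g" where
  "val lt a = (THE g. g \<in> supp a \<and> (\<forall>h\<in>supp a. h \<noteq> g \<longrightarrow> lt g h))"


section \<open>Automorphism groups\<close>

definition add_group :: "'g::ab_group_add monoid" where
  "add_group = \<lparr>carrier = UNIV, monoid.mult = (+), monoid.one = 0\<rparr>"

definition mult_group :: "'k::field monoid" where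
  "mult_group = \<lparr>carrier = - {0}, monoid.mult = (*), monoid.one = 1\<rparr>"

definition field_Aut :: "('k::field \<Rightarrow> 'k) monoid" where
  "field_Aut = BijGroup UNIV
     \<lparr>carrier := {\<rho>. bij \<rho> \<and> \<rho> 1 = 1 \<and> (\<forall>a b. \<rho> (a + b) = \<rho> a + \<rho> b) \<and>
                    (\<forall>a b. \<rho> (a * b) = \<rho> a * \<rho> b)}\<rparr>"

definition o_Aut :: "('g::ab_group_add \<Rightarrow> 'g \<Rightarrow> bool) \<Rightarrow> ('g \<Rightarrow> 'g) monoid" where
  "o_Aut lt = BijGroup UNIV
     \<lparr>carrier := {\<tau> \<in> iso add_group add_group. \<forall>g h. lt g h \<longleftrightarrow> lt (\<tau> g) (\<tau> h)}\<rparr>"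

(* As in BijGroup, maps on K are extensional, so that equal restrictions to K are equal maps. *)
definition v_Aut ::
  "('g::ab_group_add \<Rightarrow> 'g \<Rightarrow> bool) \<Rightarrow> ('g \<Rightarrow> 'k::field) set \<Rightarrow> (('g \<Rightarrow> 'k) \<Rightarrow> ('g \<Rightarrow> 'k)) monoid" where
  "v_Aut lt K = BijGroup K
     \<lparr>carrier := {\<sigma> \<in> Bij K \<inter> ring_iso (hahn_series lt\<lparr>carrier := K\<rparr>) (hahn_series lt\<lparr>carrier := K\<rparr>).
        \<exists>\<tau>\<in>carrier (o_Aut lt). \<forall>a\<in>K - {\<zero>\<^bsub>hahn_series lt\<^esub>}. \<tau> (val lt a) = val lt (\<sigma> a)}\<rparr>"

definition stabilizing_k ::
  "(('g::zero \<Rightarrow> 'k::zero) \<Rightarrow> ('g \<Rightarrow> 'k)) monoid \<Rightarrow> (('g \<Rightarrow> 'k) \<Rightarrow> ('g \<Rightarrow> 'k)) monoid" where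
  "stabilizing_k A = A\<lparr>carrier := {\<sigma> \<in> carrier A. \<sigma> ` range hahn_const = range hahn_const}\<rparr>"

definition fixing_k ::
  "(('g::zero \<Rightarrow> 'k::zero) \<Rightarrow> ('g \<Rightarrow> 'k)) monoid \<Rightarrow> (('g \<Rightarrow> 'k) \<Rightarrow> ('g \<Rightarrow> 'k)) monoid" where
  "fixing_k A = A\<lparr>carrier := {\<sigma> \<in> carrier A. \<forall>c. \<sigma> (hahn_const c) = hahn_const c}\<rparr>"


section \<open>The homomorphism \<open>\<Phi>\<close>, internal automorphisms and the first lifting property\<close>

definition induced_on_group ::
  "('g::ab_group_add \<Rightarrow> 'g \<Rightarrow> bool) \<Rightarrow> ('g \<Rightarrow> 'k::field) set \<Rightarrow> (('g \<Rightarrow> 'k) \<Rightarrow> ('g \<Rightarrow> 'k)) \<Rightarrow> 'g \<Rightarrow> 'g" where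
  "induced_on_group lt K \<sigma> =
     (THE \<tau>. \<tau> \<in> carrier (o_Aut lt) \<and>
        (\<forall>a\<in>K - {\<zero>\<^bsub>hahn_series lt\<^esub>}. \<tau> (val lt a) = val lt (\<sigma> a)))"

definition induced_on_residue_field ::
  "(('g::zero \<Rightarrow> 'k::zero) \<Rightarrow> ('g \<Rightarrow> 'k)) \<Rightarrow> 'k \<Rightarrow> 'k" where
  "induced_on_residue_field \<sigma> = (\<lambda>c. \<sigma> (hahn_const c) 0)"

definition Phi ::
  "('g::ab_group_add \<Rightarrow> 'g \<Rightarrow> bool) \<Rightarrow> ('g \<Rightarrow> 'k::field) set \<Rightarrow> (('g \<Rightarrow> 'k) \<Rightarrow> ('g \<Rightarrow> 'k))
     \<Rightarrow> ('k \<Rightarrow> 'k) \<times> ('g \<Rightarrow> 'g)" where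
  "Phi lt K \<sigma> = (induced_on_residue_field \<sigma>, induced_on_group lt K \<sigma>)"

definition Int_Aut ::
  "('g::ab_group_add \<Rightarrow> 'g \<Rightarrow> bool) \<Rightarrow> ('g \<Rightarrow> 'k::field) set \<Rightarrow> (('g \<Rightarrow> 'k) \<Rightarrow> ('g \<Rightarrow> 'k)) monoid" where
  "Int_Aut lt K = v_Aut lt K
     \<lparr>carrier := kernel (v_Aut lt K) (field_Aut \<times>\<times> o_Aut lt) (Phi lt K)\<rparr>"

definition one_Aut ::
  "('g::ab_group_add \<Rightarrow> 'g \<Rightarrow> bool) \<Rightarrow> ('g \<Rightarrow> 'k::field) set \<Rightarrow> (('g \<Rightarrow> 'k) \<Rightarrow> ('g \<Rightarrow> 'k)) monoid" where
  "one_Aut lt K = v_Aut lt K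
     \<lparr>carrier := {\<sigma> \<in> carrier (Int_Aut lt K). \<forall>g. \<sigma> (hahn_monomial g) g = 1}\<rparr>"

(* K has the first lifting property iff such a section exists. *)
definition first_lifting_section ::
  "('g::ab_group_add \<Rightarrow> 'g \<Rightarrow> bool) \<Rightarrow> ('g \<Rightarrow> 'k::field) set
     \<Rightarrow> (('k \<Rightarrow> 'k) \<times> ('g \<Rightarrow> 'g) \<Rightarrow> (('g \<Rightarrow> 'k) \<Rightarrow> ('g \<Rightarrow> 'k))) \<Rightarrow> bool" where
  "first_lifting_section lt K \<Psi> \<longleftrightarrow>
     \<Psi> \<in> hom (field_Aut \<times>\<times> o_Aut lt) (v_Aut lt K) \<and>
     inj_on \<Psi> (carrier (field_Aut \<times>\<times> o_Aut lt)) \<and>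
     (\<forall>p\<in>carrier (field_Aut \<times>\<times> o_Aut lt). Phi lt K (\<Psi> p) = p)"

(* An arbitrary section need not send the automorphisms (id, tau) to automorphisms fixing k
   pointwise: fixing_k (Ext_Aut lt K Psi) corresponds under Psi to a subgroup of
   {id} x o-Aut G that may be proper. *)
definition Ext_Aut ::
  "('g::ab_group_add \<Rightarrow> 'g \<Rightarrow> bool) \<Rightarrow> ('g \<Rightarrow> 'k::field) set
     \<Rightarrow> (('k \<Rightarrow> 'k) \<times> ('g \<Rightarrow> 'g) \<Rightarrow> (('g \<Rightarrow> 'k) \<Rightarrow> ('g \<Rightarrow> 'k))) \<Rightarrow> (('g \<Rightarrow> 'k) \<Rightarrow> ('g \<Rightarrow> 'k)) monoid" where
  "Ext_Aut lt K \<Psi> = v_Aut lt K\<lparr>carrier := \<Psi> ` carrier (field_Aut \<times>\<times> o_Aut lt)\<rparr>"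

(* The coefficient of sum a_g t^g |-> sum rho(a_g) t^(tau g) at h = tau g. *)
definition canonical_lift :: "('k \<Rightarrow> 'k) \<Rightarrow> ('g \<Rightarrow> 'g) \<Rightarrow> ('g \<Rightarrow> 'k) \<Rightarrow> ('g \<Rightarrow> 'k)" where
  "canonical_lift \<rho> \<tau> a = (\<lambda>h. \<rho> (a (inv_into UNIV \<tau> h)))"

definition canonical_first_lifting ::
  "('g::ab_group_add \<Rightarrow> 'g \<Rightarrow> bool) \<Rightarrow> ('g \<Rightarrow> 'k::field) set \<Rightarrow> bool" where
  "canonical_first_lifting lt K \<longleftrightarrow>
     (\<forall>\<rho>\<in>carrier field_Aut. \<forall>\<tau>\<in>carrier (o_Aut lt). canonical_lift \<rho> \<tau> ` K = K)"

definition canonical_section ::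
  "('g \<Rightarrow> 'k) set \<Rightarrow> ('k \<Rightarrow> 'k) \<times> ('g \<Rightarrow> 'g) \<Rightarrow> (('g \<Rightarrow> 'k) \<Rightarrow> ('g \<Rightarrow> 'k))" where
  "canonical_section K = (\<lambda>(\<rho>, \<tau>). restrict (canonical_lift \<rho> \<tau>) K)"


section \<open>The second lifting property\<close>

definition Hom_group :: "('g::ab_group_add \<Rightarrow> 'k::field) monoid" where
  "Hom_group = \<lparr>carrier = hom add_group mult_group, monoid.mult = (\<lambda>x y g. x g * y g), monoid.one = (\<lambda>g. 1)\<rparr>"

definition rho :: "('g \<Rightarrow> 'k::field) set \<Rightarrow> ('g \<Rightarrow> 'k) \<Rightarrow> (('g \<Rightarrow> 'k) \<Rightarrow> ('g \<Rightarrow> 'k))" where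
  "rho K x = (\<lambda>a\<in>K. \<lambda>g. a g * x g)"

definition canonical_second_lifting ::
  "('g::ab_group_add \<Rightarrow> 'g \<Rightarrow> bool) \<Rightarrow> ('g \<Rightarrow> 'k::field) set \<Rightarrow> bool" where
  "canonical_second_lifting lt K \<longleftrightarrow> rho K \<in> hom Hom_group (Int_Aut lt K)"

definition unit_torus :: "('n::finite \<Rightarrow> 'k::field) monoid" where
  "unit_torus = product_group UNIV (\<lambda>_. mult_group)"

definition torus_character :: "('n::finite \<Rightarrow> 'k::field) \<Rightarrow> (int ^ 'n \<Rightarrow> 'k)" where
  "torus_character x = (\<lambda>g. \<Prod>i\<in>UNIV. x i powi (g $ i))"


section \<open>Semidirect products, normal factor on the left\<close>

definition semidirect ::
  "('a, 'm) monoid_scheme \<Rightarrow> ('b, 'l) monoid_scheme \<Rightarrow> ('b \<Rightarrow> 'a \<Rightarrow> 'a) \<Rightarrow> ('a \<times> 'b) monoid" where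
  "semidirect N H \<phi> =
     \<lparr>carrier = carrier N \<times> carrier H,
      monoid.mult = (\<lambda>(n, h) (n', h'). (n \<otimes>\<^bsub>N\<^esub> \<phi> h n', h \<otimes>\<^bsub>H\<^esub> h')),
      monoid.one = (\<one>\<^bsub>N\<^esub>, \<one>\<^bsub>H\<^esub>)\<rparr>"

(* i and j identify N and H with subgroups of A, and i maps conj_action A N i j h n to the
   conjugate of i n by j h, provided this conjugate lies in the image of N. *)
definition conj_action ::
  "('c, 'p) monoid_scheme \<Rightarrow> ('a, 'm) monoid_scheme \<Rightarrow> ('a \<Rightarrow> 'c) \<Rightarrow> ('b \<Rightarrow> 'c) \<Rightarrow> 'b \<Rightarrow> 'a \<Rightarrow> 'a" where
  "conj_action A N i j h n = the_inv_into (carrier N) i (j h \<otimes>\<^bsub>A\<^esub> i n \<otimes>\<^bsub>A\<^esub> inv\<^bsub>A\<^esub> (j h))"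

definition semidirect_by_torus ::
  "(int ^ 'n::finite \<Rightarrow> int ^ 'n \<Rightarrow> bool) \<Rightarrow> (int ^ 'n \<Rightarrow> 'k::field) set
     \<Rightarrow> ((int ^ 'n \<Rightarrow> 'k) \<Rightarrow> (int ^ 'n \<Rightarrow> 'k)) monoid
     \<Rightarrow> (((int ^ 'n \<Rightarrow> 'k) \<Rightarrow> (int ^ 'n \<Rightarrow> 'k)) \<times> ('n \<Rightarrow> 'k)) monoid" where
  "semidirect_by_torus lt K N =
     semidirect N unit_torus
       (conj_action (v_Aut lt K) N (\<lambda>\<sigma>. \<sigma>) (\<lambda>x. rho K (torus_character x)))"

(* (N x| T) x| H for the torus T of n-tuples of units, where H acts through j: H -> v-Aut K
   and N x| T is identified with a subgroup of v-Aut K by (sigma, x) |-> sigma o rho_x. *)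
definition iterated_semidirect ::
  "(int ^ 'n::finite \<Rightarrow> int ^ 'n \<Rightarrow> bool) \<Rightarrow> (int ^ 'n \<Rightarrow> 'k::field) set
     \<Rightarrow> ((int ^ 'n \<Rightarrow> 'k) \<Rightarrow> (int ^ 'n \<Rightarrow> 'k)) monoid \<Rightarrow> 'h monoid
     \<Rightarrow> ('h \<Rightarrow> ((int ^ 'n \<Rightarrow> 'k) \<Rightarrow> (int ^ 'n \<Rightarrow> 'k)))
     \<Rightarrow> ((((int ^ 'n \<Rightarrow> 'k) \<Rightarrow> (int ^ 'n \<Rightarrow> 'k)) \<times> ('n \<Rightarrow> 'k)) \<times> 'h) monoid" where
  "iterated_semidirect lt K N H j =
     semidirect (semidirect_by_torus lt K N) H
       (conj_action (v_Aut lt K) (semidirect_by_torus lt K N)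
          (\<lambda>(\<sigma>, x). \<sigma> \<otimes>\<^bsub>v_Aut lt K\<^esub> rho K (torus_character x)) j)"

end

theory Submission
  imports Defs
begin

text \<open>An automorphism \<open>\<sigma>\<close> that preserves the valuation acts on lowest terms, and it does so by
  the formula \<open>c t\<^sup>g \<mapsto> \<sigma>\<^sub>k(c) \<chi>(g) t\<^bsup>\<sigma>\<^sub>G(g)\<^esup>\<close>, where \<open>\<chi>(g)\<close> is the leading coefficient
  of \<open>\<sigma>(t\<^sup>g)\<close> (lemma \<open>lowest_coeff\<close>). Since lowest terms multiply, \<open>\<chi>\<close> is a homomorphism
  \<open>G \<rightarrow> k\<^sup>\<times>\<close>, and a composite of automorphisms acts by the composite formula. So the triple
  \<open>(\<sigma>\<^sub>k, \<sigma>\<^sub>G, \<chi>)\<close> describes a homomorphism from \<open>v\<close>-\<open>Aut K\<close> to the automorphisms of the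
  group of lowest terms. Its kernel is \<open>1\<close>-\<open>Aut K\<close>, while \<open>IntAut K\<close> is the kernel of the first
  two components; both are therefore normal.

  An internal automorphism \<open>\<sigma>\<close> with character \<open>\<chi>\<close> is, up to \<open>\<rho>\<^sub>\<chi>\<close>, a 1-automorphism
  (\<open>Int_Aut_decomposition\<close>), and the character of \<open>\<rho>\<^sub>x\<close> is \<open>x\<close>; hence
  \<open>IntAut K\<close> is the semidirect product of \<open>1\<close>-\<open>Aut K\<close> and \<open>Hom(G, k\<^sup>\<times>)\<close>.
  A section of \<open>\<Phi>\<close> splits off the remaining factor. The same argument applies inside every
  subgroup \<open>B\<close> of \<open>v\<close>-\<open>Aut K\<close> that contains all \<open>\<rho>\<^sub>x\<close> and a complement of
  \<open>IntAut K \<inter> B\<close> (\<open>iterated_semidirect_decomposition\<close>). The isomorphisms of the theorem are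
  the cases in which \<open>B\<close> consists of all automorphisms, of those that fix \<open>k\<close>
  pointwise, and of those that map \<open>k\<close> onto itself. In the last case the first factor is still
  \<open>1\<close>-\<open>Aut\<^sub>k K\<close>: an automorphism that maps constants to constants acts on them through the
  residue field, so that it fixes them if it is a 1-automorphism.

  For \<open>G = \<int>\<^sup>n\<close> a character is determined by its arbitrary values on the standard basis, which
  identifies \<open>Hom(G, k\<^sup>\<times>)\<close> with the torus (\<open>torus_character_iso\<close>).\<close>


section \<open>Internal semidirect products\<close>

text \<open>The map \<open>(n, h) \<mapsto> i(n) j(h)\<close> is multiplicative because the action is conjugation by
  \<open>j(h)\<close>. Instead of requiring that the images of \<open>N\<close> and \<open>H\<close> meet trivially, it is required
  that \<open>h\<close> can be read off from the product: then \<open>N\<close> and \<open>H\<close> only have to be closed under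
  multiplication, which makes the lemma applicable again to the product itself.\<close>

lemma internal_semidirect:
  assumes "group A" and i: "i \<in> hom N A" "inj_on i (carrier N)" and j: "j \<in> hom H A"
    and normalized: "\<And>n h. n \<in> carrier N \<Longrightarrow> h \<in> carrier H \<Longrightarrow>
           j h \<otimes>\<^bsub>A\<^esub> i n \<otimes>\<^bsub>A\<^esub> inv\<^bsub>A\<^esub> (j h) \<in> i ` carrier N"
    and retract: "\<And>n h n' h'. \<lbrakk>n \<in> carrier N; h \<in> carrier H; n' \<in> carrier N; h' \<in> carrier H;
           i n \<otimes>\<^bsub>A\<^esub> j h = i n' \<otimes>\<^bsub>A\<^esub> j h'\<rbrakk> \<Longrightarrow> h = h'"
    and closed: "\<And>n n'. n \<in> carrier N \<Longrightarrow> n' \<in> carrier N \<Longrightarrow> n \<otimes>\<^bsub>N\<^esub> n' \<in> carrier N"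
      "\<And>h h'. h \<in> carrier H \<Longrightarrow> h' \<in> carrier H \<Longrightarrow> h \<otimes>\<^bsub>H\<^esub> h' \<in> carrier H"
  shows "(\<lambda>(n, h). i n \<otimes>\<^bsub>A\<^esub> j h) \<in> hom (semidirect N H (conj_action A N i j)) A"
    and "inj_on (\<lambda>(n, h). i n \<otimes>\<^bsub>A\<^esub> j h) (carrier (semidirect N H (conj_action A N i j)))"
    and "\<And>p q. p \<in> carrier (semidirect N H (conj_action A N i j)) \<Longrightarrow>
           q \<in> carrier (semidirect N H (conj_action A N i j)) \<Longrightarrow>
           p \<otimes>\<^bsub>semidirect N H (conj_action A N i j)\<^esub> q \<in> carrier (semidirect N H (conj_action A N i j))"
proof -
  interpret A: group A by fact
  let ?\<phi> = "conj_action A N i j"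
  have iA: "i n \<in> carrier A" if "n \<in> carrier N" for n
    using i that by (auto simp: hom_def)
  have jA: "j h \<in> carrier A" if "h \<in> carrier H" for h
    using j that by (auto simp: hom_def)
  have \<phi>: "?\<phi> h n \<in> carrier N" "i (?\<phi> h n) = j h \<otimes>\<^bsub>A\<^esub> i n \<otimes>\<^bsub>A\<^esub> inv\<^bsub>A\<^esub> (j h)"
    if "n \<in> carrier N" "h \<in> carrier H" for n h
    using normalized[OF that] i(2) unfolding conj_action_def
    by (auto intro: the_inv_into_into f_the_inv_into_f)
  show "(\<lambda>(n, h). i n \<otimes>\<^bsub>A\<^esub> j h) \<in> hom (semidirect N H ?\<phi>) A"
  proof (rule homI, goal_cases)
    case (1 p)
    then show ?case by (auto simp: semidirect_def iA jA)
  next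
    case (2 p q)
    then obtain n h n' h' where pq: "p = (n, h)" "q = (n', h')"
      and c: "n \<in> carrier N" "h \<in> carrier H" "n' \<in> carrier N" "h' \<in> carrier H"
      by (auto simp: semidirect_def)
    have "i (n \<otimes>\<^bsub>N\<^esub> ?\<phi> h n') = i n \<otimes>\<^bsub>A\<^esub> (j h \<otimes>\<^bsub>A\<^esub> i n' \<otimes>\<^bsub>A\<^esub> inv\<^bsub>A\<^esub> (j h))"
      using i(1) c \<phi>[of n' h] by (simp add: hom_def)
    moreover have "j (h \<otimes>\<^bsub>H\<^esub> h') = j h \<otimes>\<^bsub>A\<^esub> j h'"
      using j c by (simp add: hom_def)
    moreover have "inv\<^bsub>A\<^esub> (j h) \<otimes>\<^bsub>A\<^esub> (j h \<otimes>\<^bsub>A\<^esub> j h') = j h'"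
      using c by (simp add: jA A.m_assoc[symmetric])
    ultimately show ?case
      using c by (simp add: pq semidirect_def iA jA A.m_assoc)
  qed
  show "inj_on (\<lambda>(n, h). i n \<otimes>\<^bsub>A\<^esub> j h) (carrier (semidirect N H ?\<phi>))"
  proof (rule inj_onI, goal_cases)
    case (1 p q)
    then obtain n h n' h' where pq: "p = (n, h)" "q = (n', h')"
      and c: "n \<in> carrier N" "h \<in> carrier H" "n' \<in> carrier N" "h' \<in> carrier H"
      and eq: "i n \<otimes>\<^bsub>A\<^esub> j h = i n' \<otimes>\<^bsub>A\<^esub> j h'"
      by (auto simp: semidirect_def)
    have h: "h = h'" using retract c eq by blast
    then have "i n = i n'" using eq c by (simp add: iA jA)
    then show ?case using i(2) c h by (simp add: pq inj_on_def)
  qed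
  show "p \<otimes>\<^bsub>semidirect N H ?\<phi>\<^esub> q \<in> carrier (semidirect N H ?\<phi>)"
    if "p \<in> carrier (semidirect N H ?\<phi>)" "q \<in> carrier (semidirect N H ?\<phi>)" for p q
    using that by (auto simp: semidirect_def closed \<phi>)
qed

lemma subgroup_iso_of_injective_hom:
  assumes f: "f \<in> hom S A" "inj_on f (carrier S)" and B: "f ` carrier S = B"
    and closed: "\<And>p q. p \<in> carrier S \<Longrightarrow> q \<in> carrier S \<Longrightarrow> p \<otimes>\<^bsub>S\<^esub> q \<in> carrier S"
  shows "A\<lparr>carrier := B\<rparr> \<cong> S"
proof (rule is_isoI)
  let ?g = "the_inv_into (carrier S) f"
  have bij: "bij_betw ?g B (carrier S)"
    using f B by (intro bij_betw_the_inv_into) (simp add: bij_betw_def)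
  have "?g (x \<otimes>\<^bsub>A\<^esub> y) = ?g x \<otimes>\<^bsub>S\<^esub> ?g y" if xy: "x \<in> B" "y \<in> B" for x y
  proof -
    obtain p q where pq: "p \<in> carrier S" "q \<in> carrier S" "x = f p" "y = f q"
      using xy B by blast
    then have "x \<otimes>\<^bsub>A\<^esub> y = f (p \<otimes>\<^bsub>S\<^esub> q)"
      using f by (simp add: hom_def)
    then show ?thesis
      using pq f closed by (simp add: the_inv_into_f_f)
  qed
  then show "?g \<in> iso (A\<lparr>carrier := B\<rparr>) S"
    using bij by (auto simp: iso_def hom_def bij_betw_def)
qed


text \<open>The groups of automorphisms are records that differ from each other in the carrier only. This
  lets the carrier of such a record be named by the record itself.\<close>

lemma carrier_update_carrier:
  fixes R :: "'a monoid"
  shows "R\<lparr>carrier := carrier (R\<lparr>carrier := B\<rparr>)\<rparr> = R\<lparr>carrier := B\<rparr>"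
  by simp


lemma carrier_Hom_group: "x \<in> carrier Hom_group \<longleftrightarrow>
    (\<forall>g. x g \<noteq> (0::'k::field)) \<and> (\<forall>g h. x (g + h) = x g * x (h::'g::ab_group_add))"
  by (auto simp: Hom_group_def hom_def add_group_def mult_group_def Pi_iff)


section \<open>The lowest terms of series in a Hahn field\<close>

locale ordered_hahn_field =
  fixes lt :: "'g::ab_group_add \<Rightarrow> 'g \<Rightarrow> bool" and K :: "('g \<Rightarrow> 'k::field) set"
  assumes ordering: "group_ordering lt" and hahn_field: "hahn_field lt K"
begin

abbreviation hahn_mult :: "('g \<Rightarrow> 'k) \<Rightarrow> ('g \<Rightarrow> 'k) \<Rightarrow> ('g \<Rightarrow> 'k)" (infixl \<open>\<star>\<close> 70)
  where "a \<star> b \<equiv> a \<otimes>\<^bsub>hahn_series lt\<^esub> b"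

abbreviation "V \<equiv> v_Aut lt K"

abbreviation "Aut_kG \<equiv> (field_Aut :: ('k \<Rightarrow> 'k) monoid) \<times>\<times> o_Aut lt"

lemma lt_irrefl: "\<not> lt a a"
  and lt_trans: "lt a b \<Longrightarrow> lt b c \<Longrightarrow> lt a c"
  and lt_total: "a \<noteq> b \<Longrightarrow> lt a b \<or> lt b a"
  and lt_add: "lt a b \<Longrightarrow> lt (a + c) (b + c)"
  using ordering unfolding group_ordering_def irreflp_def transp_def totalp_on_def
  by blast+

lemma lt_add_iff: "lt (a + c) (b + c) \<longleftrightarrow> lt a b"
  using lt_add[of a b c] lt_add[of "a + c" "b + c" "- c"] by auto

text \<open>The set of series of value at least \<open>g\<close>; describing it by coefficients avoids
  the undefined value of the zero series.\<close>

definition value_ge :: "'g \<Rightarrow> ('g \<Rightarrow> 'k) set" where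
  "value_ge g = {a. \<forall>h. lt h g \<longrightarrow> a h = 0}"

lemma mult_eq: "(a \<star> b) g = (\<Sum>h\<in>{h. h \<in> supp a \<and> g - h \<in> supp b}. a h * b (g - h))"
  by (simp add: hahn_series_def)

text \<open>Lowest terms multiply: for series of values at least \<open>g\<close> and \<open>h\<close>, the only pair of
  exponents that contributes to \<open>t\<^bsup>g + h\<^esup>\<close> is \<open>(g, h)\<close>.\<close>

lemma lowest_coeff_mult:
  assumes a: "a \<in> value_ge g" and b: "b \<in> value_ge h"
  shows "(a \<star> b) (g + h) = a g * b h"
proof -
  let ?I = "{f. f \<in> supp a \<and> g + h - f \<in> supp b}"
  have sub: "?I \<subseteq> {g}"
  proof (rule subsetI, rule ccontr)
    fix f assume f: "f \<in> ?I" "f \<notin> {g}"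
    have "\<not> lt f g" using f a by (auto simp: value_ge_def supp_def)
    then have "lt g f" using lt_total f by blast
    then have "lt (g + (h - f)) (f + (h - f))" by (simp only: lt_add_iff)
    then have "lt (g + h - f) h" by (simp add: algebra_simps)
    then show False using f b by (auto simp: value_ge_def supp_def)
  qed
  show ?thesis
  proof (cases "g \<in> ?I")
    case True
    then have "?I = {g}" using sub by blast
    then show ?thesis unfolding mult_eq by simp
  next
    case False
    then have "?I = {}" using sub by blast
    moreover have "a g * b h = 0" using False by (auto simp: supp_def)
    ultimately show ?thesis by (simp only: mult_eq sum.empty)
  qed
qed

lemma mult_const: "hahn_const c \<star> a = (\<lambda>g. c * a g)"
proof
  fix g
  have "{h. h \<in> supp (hahn_const c) \<and> g - h \<in> supp a} =
      (if c \<noteq> 0 \<and> a g \<noteq> 0 then {0} else {})"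
    by (auto simp: supp_def hahn_const_def split: if_splits)
  then show "(hahn_const c \<star> a) g = c * a g"
    by (simp add: mult_eq hahn_const_def)
qed

lemma mult_monomial: "a \<star> hahn_monomial g = (\<lambda>h. a (h - g))"
proof
  fix h
  have "{f. f \<in> supp a \<and> h - f \<in> supp (hahn_monomial g :: 'g \<Rightarrow> 'k)} =
      (if a (h - g) \<noteq> 0 then {h - g} else {})"
    by (auto simp: supp_def hahn_monomial_def algebra_simps split: if_splits)
  then show "(a \<star> hahn_monomial g) h = a (h - g)"
    by (simp add: mult_eq hahn_monomial_def)
qed

lemma one_eq: "\<one>\<^bsub>hahn_series lt\<^esub> = hahn_const 1" and zero_eq: "\<zero>\<^bsub>hahn_series lt\<^esub> = (\<lambda>g. 0)"
  and add_eq: "a \<oplus>\<^bsub>hahn_series lt\<^esub> b = (\<lambda>g. a g + b g)"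
  by (auto simp: hahn_series_def hahn_const_def)

lemma monomial_0: "hahn_monomial 0 = hahn_const 1"
  by (auto simp: hahn_monomial_def hahn_const_def)

lemma const_mult: "hahn_const c \<star> hahn_const d = hahn_const (c * d)"
  unfolding mult_const by (auto simp: hahn_const_def)

lemma monomial_mult: "(hahn_monomial g :: 'g \<Rightarrow> 'k) \<star> hahn_monomial h = hahn_monomial (g + h)"
  unfolding mult_monomial by (auto simp: hahn_monomial_def algebra_simps)

lemma K_subfield: "subfield K (hahn_series lt)"
  using hahn_field by (simp add: hahn_field_def)

lemma K_subring: "subring K (hahn_series lt)"
  using K_subfield by (simp add: subfield_def subdomain_def subcring_def)

lemma wfp_supp: "a \<in> K \<Longrightarrow> wfp_on (supp a) lt"
  using subring.axioms(2)[OF K_subring] by (auto simp: submonoid_def hahn_series_def)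

lemma mult_closed: "a \<in> K \<Longrightarrow> b \<in> K \<Longrightarrow> a \<star> b \<in> K"
  using subring.axioms(2)[OF K_subring] by (auto simp: submonoid_def)

lemma one_closed: "hahn_const 1 \<in> K"
  using subring.axioms(2)[OF K_subring] by (auto simp: submonoid_def one_eq)

lemma zero_closed: "(\<lambda>g. 0) \<in> K"
  using subgroup.one_closed[OF subring.axioms(1)[OF K_subring]] by (simp add: zero_eq)

lemma add_closed: "a \<in> K \<Longrightarrow> b \<in> K \<Longrightarrow> (\<lambda>g. a g + b g) \<in> K"
  using subgroup.m_closed[OF subring.axioms(1)[OF K_subring], of a b] by (simp add: add_eq)

text \<open>For \<open>b = 1\<close> the fractions \<open>a / b\<close> in \<open>k(G)\<close> are the elements of the group ring.\<close>

lemma group_ring_subset: "group_ring \<subseteq> K"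
proof
  fix a :: "'g \<Rightarrow> 'k" assume a: "a \<in> group_ring"
  let ?R = "hahn_series lt :: ('g \<Rightarrow> 'k) ring"
  have one: "\<one>\<^bsub>?R\<^esub> \<in> carrier ?R"
    using subring.axioms(2)[OF K_subring] by (auto simp: submonoid_def)
  have mult_one: "b \<star> \<one>\<^bsub>?R\<^esub> = b" "\<one>\<^bsub>?R\<^esub> \<star> b = b" for b
    using mult_monomial[of b 0] by (simp_all add: one_eq mult_const monomial_0)
  have inv_one: "inv\<^bsub>?R\<^esub> \<one>\<^bsub>?R\<^esub> = \<one>\<^bsub>?R\<^esub>"
    unfolding m_inv_def by (rule the_equality) (use one mult_one in auto)
  have "\<one>\<^bsub>?R\<^esub> \<in> group_ring" "\<one>\<^bsub>?R\<^esub> \<noteq> \<zero>\<^bsub>?R\<^esub>"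
    by (auto simp: group_ring_def supp_def one_eq zero_eq hahn_const_def fun_eq_iff)
  moreover have "a = a \<star> inv\<^bsub>?R\<^esub> \<one>\<^bsub>?R\<^esub>" by (simp add: inv_one mult_one)
  ultimately have "a \<in> group_ring_fractions lt"
    unfolding group_ring_fractions_def using a by blast
  then show "a \<in> K" using hahn_field by (auto simp: hahn_field_def)
qed

lemma const_closed: "hahn_const c \<in> K"
  using group_ring_subset by (auto simp: group_ring_def supp_def hahn_const_def subset_eq)

lemma monomial_closed: "hahn_monomial g \<in> K"
  using group_ring_subset by (auto simp: group_ring_def supp_def hahn_monomial_def subset_eq)

lemma uminus_closed: "a \<in> K \<Longrightarrow> (\<lambda>g. - a g) \<in> K"
  using mult_closed[OF const_closed[of "- 1"]] by (simp add: mult_const)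

lemma diff_closed: "a \<in> K \<Longrightarrow> b \<in> K \<Longrightarrow> (\<lambda>g. a g - b g) \<in> K"
  using add_closed[OF _ uminus_closed] by simp

lemma val_eqI:
  assumes "g \<in> supp a" "\<And>h. h \<in> supp a \<Longrightarrow> h \<noteq> g \<Longrightarrow> lt g h"
  shows "val lt a = g"
  unfolding val_def
proof (rule the_equality)
  fix f assume f: "f \<in> supp a \<and> (\<forall>h\<in>supp a. h \<noteq> f \<longrightarrow> lt f h)"
  show "f = g"
  proof (rule ccontr)
    assume "f \<noteq> g"
    then have "lt f g" "lt g f" using assms f by auto
    then show False using lt_trans lt_irrefl by blast
  qed
qed (use assms in auto)

lemma val_monomial: "val lt (hahn_monomial g :: 'g \<Rightarrow> 'k) = g"
  by (rule val_eqI) (auto simp: supp_def hahn_monomial_def split: if_splits)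

lemma val_least:
  assumes "a \<in> K" "a \<noteq> (\<lambda>g. 0)"
  shows "val lt a \<in> supp a" and "h \<in> supp a \<Longrightarrow> h \<noteq> val lt a \<Longrightarrow> lt (val lt a) h"
proof -
  have "supp a \<noteq> {}" using assms by (auto simp: supp_def)
  then have "\<exists>z\<in>supp a. \<forall>y. lt y z \<longrightarrow> y \<notin> supp a"
    using wfp_supp[OF assms(1)] unfolding wfp_on_iff_ex_minimal by simp
  then obtain z where z: "z \<in> supp a" "\<And>y. y \<in> supp a \<Longrightarrow> \<not> lt y z"
    by auto
  then have least: "lt z y" if "y \<in> supp a" "y \<noteq> z" for y using that lt_total by blast
  then have "val lt a = z" using z by (intro val_eqI) auto
  then show "val lt a \<in> supp a" "h \<in> supp a \<Longrightarrow> h \<noteq> val lt a \<Longrightarrow> lt (val lt a) h"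
    using z least by auto
qed


section \<open>Valuation preserving automorphisms\<close>

lemma carrier_o_Aut: "\<tau> \<in> carrier (o_Aut lt) \<longleftrightarrow>
    bij \<tau> \<and> (\<forall>g h. \<tau> (g + h) = \<tau> g + \<tau> h) \<and> (\<forall>g h. lt g h \<longleftrightarrow> lt (\<tau> g) (\<tau> h))"
  by (auto simp: o_Aut_def iso_def hom_def add_group_def)

lemma o_Aut_0: "\<tau> \<in> carrier (o_Aut lt) \<Longrightarrow> \<tau> 0 = 0"
  unfolding carrier_o_Aut by (metis add_cancel_right_left)

lemma mult_o_Aut: "\<tau> \<in> carrier (o_Aut lt) \<Longrightarrow> \<tau>' \<in> carrier (o_Aut lt) \<Longrightarrow>
    \<tau> \<otimes>\<^bsub>o_Aut lt\<^esub> \<tau>' = \<tau> \<circ> \<tau>'"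
  by (auto simp: carrier_o_Aut) (auto simp: o_Aut_def BijGroup_def Bij_def compose_def)

lemma o_Aut_comp: "\<tau> \<in> carrier (o_Aut lt) \<Longrightarrow> \<tau>' \<in> carrier (o_Aut lt) \<Longrightarrow>
    \<tau> \<circ> \<tau>' \<in> carrier (o_Aut lt)"
  by (auto simp: carrier_o_Aut bij_comp)

lemma o_Aut_inv:
  assumes "\<tau> \<in> carrier (o_Aut lt)" shows "inv_into UNIV \<tau> \<in> carrier (o_Aut lt)"
proof -
  have \<tau>: "bij \<tau>" "\<And>g h. \<tau> (g + h) = \<tau> g + \<tau> h" "\<And>g h. lt g h \<longleftrightarrow> lt (\<tau> g) (\<tau> h)"
    using assms by (auto simp: carrier_o_Aut)
  have "\<tau> (inv_into UNIV \<tau> g) = g" for g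
    using \<tau>(1) by (simp add: bij_is_surj surj_f_inv_f)
  note \<tau>_inv = this
  have "inv_into UNIV \<tau> (g + h) = inv_into UNIV \<tau> g + inv_into UNIV \<tau> h" for g h
    using injD[OF bij_is_inj[OF \<tau>(1)]] by (simp add: \<tau>(2) \<tau>_inv)
  moreover have "lt (inv_into UNIV \<tau> g) (inv_into UNIV \<tau> h) \<longleftrightarrow> lt g h" for g h
    using \<tau>(3)[of "inv_into UNIV \<tau> g" "inv_into UNIV \<tau> h"] by (simp add: \<tau>_inv)
  ultimately show ?thesis
    by (simp add: carrier_o_Aut bij_imp_bij_inv \<tau>(1))
qed

lemma carrier_field_Aut: "\<rho> \<in> carrier field_Aut \<longleftrightarrow> bij \<rho> \<and> \<rho> 1 = 1 \<and>
    (\<forall>a b. \<rho> (a + b) = \<rho> a + \<rho> b) \<and> (\<forall>a b. \<rho> (a * b) = \<rho> a * \<rho> b)"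
  by (simp add: field_Aut_def)

lemma field_Aut_0: "\<rho> \<in> carrier field_Aut \<Longrightarrow> \<rho> 0 = 0"
  unfolding carrier_field_Aut by (metis add_cancel_right_left)

lemma mult_field_Aut: "\<rho> \<in> carrier field_Aut \<Longrightarrow> \<rho>' \<in> carrier field_Aut \<Longrightarrow>
    \<rho> \<otimes>\<^bsub>field_Aut\<^esub> \<rho>' = \<rho> \<circ> \<rho>'"
  by (auto simp: carrier_field_Aut) (auto simp: field_Aut_def BijGroup_def Bij_def compose_def)

lemma field_Aut_comp: "\<rho> \<in> carrier field_Aut \<Longrightarrow> \<rho>' \<in> carrier field_Aut \<Longrightarrow>
    \<rho> \<circ> \<rho>' \<in> carrier field_Aut"
  by (auto simp: carrier_field_Aut bij_comp)

lemma carrier_V: "\<sigma> \<in> carrier V \<longleftrightarrow>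
    \<sigma> \<in> Bij K \<and> (\<forall>a\<in>K. \<forall>b\<in>K. \<sigma> (\<lambda>g. a g + b g) = (\<lambda>g. \<sigma> a g + \<sigma> b g)) \<and>
    (\<forall>a\<in>K. \<forall>b\<in>K. \<sigma> (a \<star> b) = \<sigma> a \<star> \<sigma> b) \<and> \<sigma> (hahn_const 1) = hahn_const 1 \<and>
    (\<exists>\<tau>\<in>carrier (o_Aut lt). \<forall>a\<in>K - {\<lambda>g. 0}. \<tau> (val lt a) = val lt (\<sigma> a))"
proof -
  have "\<sigma> \<in> ring_iso (hahn_series lt\<lparr>carrier := K\<rparr>) (hahn_series lt\<lparr>carrier := K\<rparr>) \<longleftrightarrow>
      (\<forall>a\<in>K. \<forall>b\<in>K. \<sigma> (\<lambda>g. a g + b g) = (\<lambda>g. \<sigma> a g + \<sigma> b g)) \<and>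
      (\<forall>a\<in>K. \<forall>b\<in>K. \<sigma> (a \<star> b) = \<sigma> a \<star> \<sigma> b) \<and> \<sigma> (hahn_const 1) = hahn_const 1"
    if "\<sigma> \<in> Bij K"
    using that Bij_imp_funcset[OF that]
    by (simp add: ring_iso_def ring_hom_def one_eq add_eq Bij_def ball_conj_distrib) blast
  then show ?thesis by (simp add: v_Aut_def zero_eq) blast
qed

lemma
  assumes "\<sigma> \<in> carrier V"
  shows V_Bij: "\<sigma> \<in> Bij K"
    and V_add: "a \<in> K \<Longrightarrow> b \<in> K \<Longrightarrow> \<sigma> (\<lambda>g. a g + b g) = (\<lambda>g. \<sigma> a g + \<sigma> b g)"
    and V_mult: "a \<in> K \<Longrightarrow> b \<in> K \<Longrightarrow> \<sigma> (a \<star> b) = \<sigma> a \<star> \<sigma> b"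
    and V_one: "\<sigma> (hahn_const 1) = hahn_const 1"
  using assms unfolding carrier_V by auto

lemma V_val:
  assumes "\<sigma> \<in> carrier V"
  obtains \<tau> where "\<tau> \<in> carrier (o_Aut lt)"
    and "\<And>a. a \<in> K \<Longrightarrow> a \<noteq> (\<lambda>g. 0) \<Longrightarrow> val lt (\<sigma> a) = \<tau> (val lt a)"
proof -
  obtain \<tau> where "\<tau> \<in> carrier (o_Aut lt)" "\<forall>a\<in>K - {\<lambda>g. 0}. \<tau> (val lt a) = val lt (\<sigma> a)"
    using assms unfolding carrier_V by (elim conjE bexE)
  then show thesis using that by simp
qed

lemma V_I:
  assumes "\<sigma> \<in> Bij K"
    and "\<And>a b. a \<in> K \<Longrightarrow> b \<in> K \<Longrightarrow> \<sigma> (\<lambda>g. a g + b g) = (\<lambda>g. \<sigma> a g + \<sigma> b g)"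
    and "\<And>a b. a \<in> K \<Longrightarrow> b \<in> K \<Longrightarrow> \<sigma> (a \<star> b) = \<sigma> a \<star> \<sigma> b"
    and "\<sigma> (hahn_const 1) = hahn_const 1"
    and "\<tau> \<in> carrier (o_Aut lt)"
    and "\<And>a. a \<in> K \<Longrightarrow> a \<noteq> (\<lambda>g. 0) \<Longrightarrow> val lt (\<sigma> a) = \<tau> (val lt a)"
  shows "\<sigma> \<in> carrier V"
  unfolding carrier_V using assms(1,4) by (intro conjI ballI bexI[OF _ assms(5)]) (simp_all add: assms(2,3,6))

lemma V_closed: "\<sigma> \<in> carrier V \<Longrightarrow> a \<in> K \<Longrightarrow> \<sigma> a \<in> K"
  using V_Bij Bij_imp_funcset by blast

lemma V_zero:
  assumes "\<sigma> \<in> carrier V" shows "\<sigma> (\<lambda>g. 0) = (\<lambda>g. 0)"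
proof
  fix g
  have "\<sigma> (\<lambda>g. 0) g + \<sigma> (\<lambda>g. 0) g = \<sigma> (\<lambda>g. 0) g"
    using fun_cong[OF V_add[OF assms zero_closed zero_closed], of g] by simp
  then show "\<sigma> (\<lambda>g. 0) g = 0" by (simp only: add_cancel_left_left)
qed

lemma V_inj: "\<sigma> \<in> carrier V \<Longrightarrow> inj_on \<sigma> K"
  using V_Bij by (auto simp: Bij_def bij_betw_def)

lemma V_eq_zero_iff:
  assumes "\<sigma> \<in> carrier V" "a \<in> K" shows "\<sigma> a = (\<lambda>g. 0) \<longleftrightarrow> a = (\<lambda>g. 0)"
  using inj_on_eq_iff[OF V_inj[OF assms(1)] assms(2) zero_closed] V_zero[OF assms(1)] by simp

lemma V_diff:
  assumes "\<sigma> \<in> carrier V" "a \<in> K" "b \<in> K"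
  shows "\<sigma> (\<lambda>g. a g - b g) = (\<lambda>g. \<sigma> a g - \<sigma> b g)"
  using V_add[OF assms(1) diff_closed[OF assms(2,3)] assms(3)] by (simp add: fun_eq_iff)

lemma mult_V_BijGroup: "\<sigma> \<otimes>\<^bsub>V\<^esub> \<sigma>' = \<sigma> \<otimes>\<^bsub>BijGroup K\<^esub> \<sigma>'"
  by (simp add: v_Aut_def)

lemma V_comp:
  assumes "\<sigma> \<in> carrier V" "\<sigma>' \<in> carrier V" "a \<in> K" shows "(\<sigma> \<otimes>\<^bsub>V\<^esub> \<sigma>') a = \<sigma> (\<sigma>' a)"
  using assms V_Bij by (simp add: mult_V_BijGroup BijGroup_def compose_def)

lemma one_V: "\<one>\<^bsub>V\<^esub> = (\<lambda>a\<in>K. a)"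
  by (simp add: v_Aut_def BijGroup_def)

lemma group_V: "group V"
proof -
  interpret B: group "BijGroup K" by (rule group_BijGroup)
  have "subgroup (carrier V) (BijGroup K)"
  proof (rule B.subgroupI)
    show "carrier V \<subseteq> carrier (BijGroup K)" using V_Bij by (auto simp: BijGroup_def)
    have "(\<lambda>a\<in>K. a) \<in> carrier V"
      by (rule V_I[where \<tau> = id])
        (simp_all add: id_Bij one_closed add_closed mult_closed carrier_o_Aut)
    then show "carrier V \<noteq> {}" by blast
  next
    fix \<sigma> \<sigma>' assume \<sigma>: "\<sigma> \<in> carrier V" "\<sigma>' \<in> carrier V"
    obtain \<tau> where \<tau>: "\<tau> \<in> carrier (o_Aut lt)"
      "\<And>a. a \<in> K \<Longrightarrow> a \<noteq> (\<lambda>g. 0) \<Longrightarrow> val lt (\<sigma> a) = \<tau> (val lt a)"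
      using V_val[OF \<sigma>(1)] by metis
    obtain \<tau>' where \<tau>': "\<tau>' \<in> carrier (o_Aut lt)"
      "\<And>a. a \<in> K \<Longrightarrow> a \<noteq> (\<lambda>g. 0) \<Longrightarrow> val lt (\<sigma>' a) = \<tau>' (val lt a)"
      using V_val[OF \<sigma>(2)] by metis
    have "\<sigma> \<otimes>\<^bsub>V\<^esub> \<sigma>' \<in> carrier V"
    proof (rule V_I[where \<tau> = "\<tau> \<circ> \<tau>'"])
      show "\<sigma> \<otimes>\<^bsub>V\<^esub> \<sigma>' \<in> Bij K"
        using \<sigma> V_Bij compose_Bij[of \<sigma> K \<sigma>'] by (simp add: mult_V_BijGroup BijGroup_def)
      show "val lt ((\<sigma> \<otimes>\<^bsub>V\<^esub> \<sigma>') a) = (\<tau> \<circ> \<tau>') (val lt a)" if "a \<in> K" "a \<noteq> (\<lambda>g. 0)" for a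
        using that \<sigma> \<tau>(2)[of "\<sigma>' a"] \<tau>'(2)[of a] V_eq_zero_iff[of \<sigma>' a]
        by (simp add: V_comp V_closed)
      show "\<tau> \<circ> \<tau>' \<in> carrier (o_Aut lt)" using \<tau> \<tau>' o_Aut_comp by blast
    qed (use \<sigma> in \<open>simp_all add: V_comp V_add V_mult V_one V_closed add_closed mult_closed one_closed\<close>)
    then show "\<sigma> \<otimes>\<^bsub>BijGroup K\<^esub> \<sigma>' \<in> carrier V" by (simp only: mult_V_BijGroup)
  next
    fix \<sigma> assume \<sigma>: "\<sigma> \<in> carrier V"
    then obtain \<tau> where \<tau>: "\<tau> \<in> carrier (o_Aut lt)"
      and val: "\<And>a. a \<in> K \<Longrightarrow> a \<noteq> (\<lambda>g. 0) \<Longrightarrow> val lt (\<sigma> a) = \<tau> (val lt a)"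
      using V_val[OF \<sigma>] by metis
    define s where "s = (\<lambda>a\<in>K. inv_into K \<sigma> a)"
    have s: "s \<in> Bij K" unfolding s_def using V_Bij[OF \<sigma>] by (rule restrict_inv_into_Bij)
    have "\<sigma> ` K = K" using V_Bij[OF \<sigma>] by (simp add: Bij_def bij_betw_def)
    then have sK: "s a \<in> K" "\<sigma> (s a) = a" if "a \<in> K" for a
      using that by (simp_all add: s_def inv_into_into f_inv_into_f)
    have s_eqI: "s a = b" if "a \<in> K" "b \<in> K" "\<sigma> b = a" for a b
      using that V_inj[OF \<sigma>] by (auto simp: s_def)
    have s0: "s a \<noteq> (\<lambda>g. 0)" if "a \<in> K" "a \<noteq> (\<lambda>g. 0)" for a
      using sK[OF that(1)] that(2) V_eq_zero_iff[OF \<sigma>] by metis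
    have inv_\<tau>: "inv_into UNIV \<tau> (\<tau> g) = g" for g
      using \<tau> by (simp add: carrier_o_Aut bij_is_inj)
    have "s \<in> carrier V"
    proof (rule V_I[where \<tau> = "inv_into UNIV \<tau>"])
      show "s (\<lambda>g. a g + b g) = (\<lambda>g. s a g + s b g)" if ab: "a \<in> K" "b \<in> K" for a b
      proof (rule s_eqI)
        show "\<sigma> (\<lambda>g. s a g + s b g) = (\<lambda>g. a g + b g)"
          using V_add[OF \<sigma> sK(1)[OF ab(1)] sK(1)[OF ab(2)]] by (simp only: sK(2) ab)
      qed (intro add_closed sK ab)+
      show "s (a \<star> b) = s a \<star> s b" if ab: "a \<in> K" "b \<in> K" for a b
      proof (rule s_eqI)
        show "\<sigma> (s a \<star> s b) = a \<star> b"
          using V_mult[OF \<sigma> sK(1)[OF ab(1)] sK(1)[OF ab(2)]] by (simp only: sK(2) ab)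
      qed (intro mult_closed sK ab)+
      show "s (hahn_const 1) = hahn_const 1"
        by (rule s_eqI) (fact one_closed V_one[OF \<sigma>])+
      show "val lt (s a) = inv_into UNIV \<tau> (val lt a)" if "a \<in> K" "a \<noteq> (\<lambda>g. 0)" for a
        using val[OF sK(1)[OF that(1)] s0[OF that]] inv_\<tau> sK(2)[OF that(1)] by metis
    qed (fact s o_Aut_inv[OF \<tau>])+
    then show "inv\<^bsub>BijGroup K\<^esub> \<sigma> \<in> carrier V"
      using V_Bij[OF \<sigma>] by (simp add: inv_BijGroup s_def)
  qed
  then have "group (BijGroup K\<lparr>carrier := carrier V\<rparr>)" by (rule B.subgroup_imp_group)
  also have "BijGroup K\<lparr>carrier := carrier V\<rparr> = V"
    unfolding v_Aut_def by (rule carrier_update_carrier)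
  finally show ?thesis .
qed

sublocale V: group V by (rule group_V)

lemma V_eqI:
  assumes "\<sigma> \<in> carrier V" "\<sigma>' \<in> carrier V" "\<And>a. a \<in> K \<Longrightarrow> \<sigma> a = \<sigma>' a"
  shows "\<sigma> = \<sigma>'"
  using assms(3) by (intro extensionalityI[where A = K] Bij_imp_extensional V_Bij assms(1,2))


section \<open>The action on lowest terms\<close>

text \<open>The action of \<open>\<sigma>\<close> on lowest terms is \<open>c t\<^sup>g \<mapsto> \<sigma>\<^sub>k(c) \<chi>(g) t\<^bsup>\<sigma>\<^sub>G(g)\<^esup>\<close>,
  and \<open>\<chi>\<close> is the following function.\<close>

definition twist :: "(('g \<Rightarrow> 'k) \<Rightarrow> ('g \<Rightarrow> 'k)) \<Rightarrow> 'g \<Rightarrow> 'k" where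
  "twist \<sigma> g = \<sigma> (hahn_monomial g) (induced_on_group lt K \<sigma> g)"

lemma monomial_nonzero: "(hahn_monomial g :: 'g \<Rightarrow> 'k) \<noteq> (\<lambda>h. 0)"
  by (auto simp: hahn_monomial_def fun_eq_iff)

lemma induced_on_group_eqI:
  assumes "\<tau> \<in> carrier (o_Aut lt)"
    and "\<And>a. a \<in> K \<Longrightarrow> a \<noteq> (\<lambda>g. 0) \<Longrightarrow> val lt (\<sigma> a) = \<tau> (val lt a)"
  shows "induced_on_group lt K \<sigma> = \<tau>"
  unfolding induced_on_group_def zero_eq
proof (rule the_equality)
  show "\<tau> \<in> carrier (o_Aut lt) \<and> (\<forall>a\<in>K - {\<lambda>g. 0}. \<tau> (val lt a) = val lt (\<sigma> a))"
    using assms by simp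
next
  fix \<tau>' assume \<tau>': "\<tau>' \<in> carrier (o_Aut lt) \<and> (\<forall>a\<in>K - {\<lambda>g. 0}. \<tau>' (val lt a) = val lt (\<sigma> a))"
  show "\<tau>' = \<tau>"
  proof
    fix g
    have m: "hahn_monomial g \<in> K" "(hahn_monomial g :: 'g \<Rightarrow> 'k) \<noteq> (\<lambda>h. 0)"
      by (rule monomial_closed monomial_nonzero)+
    then have "\<tau>' (val lt (hahn_monomial g :: 'g \<Rightarrow> 'k)) = \<tau> (val lt (hahn_monomial g :: 'g \<Rightarrow> 'k))"
      using \<tau>' assms(2)[OF m] by simp
    then show "\<tau>' g = \<tau> g" by (simp only: val_monomial)
  qed
qed

lemma
  assumes "\<sigma> \<in> carrier V"
  shows induced_on_group_o_Aut: "induced_on_group lt K \<sigma> \<in> carrier (o_Aut lt)"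
    and induced_on_group_val:
      "a \<in> K \<Longrightarrow> a \<noteq> (\<lambda>g. 0) \<Longrightarrow> val lt (\<sigma> a) = induced_on_group lt K \<sigma> (val lt a)"
proof -
  obtain \<tau> where \<tau>: "\<tau> \<in> carrier (o_Aut lt)"
    "\<And>a. a \<in> K \<Longrightarrow> a \<noteq> (\<lambda>g. 0) \<Longrightarrow> val lt (\<sigma> a) = \<tau> (val lt a)"
    using V_val[OF assms] by metis
  then have "induced_on_group lt K \<sigma> = \<tau>" by (rule induced_on_group_eqI)
  then show "induced_on_group lt K \<sigma> \<in> carrier (o_Aut lt)"
    "a \<in> K \<Longrightarrow> a \<noteq> (\<lambda>g. 0) \<Longrightarrow> val lt (\<sigma> a) = induced_on_group lt K \<sigma> (val lt a)"
    using \<tau> by simp_all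
qed

lemma induced_on_group_0: "\<sigma> \<in> carrier V \<Longrightarrow> induced_on_group lt K \<sigma> 0 = 0"
  by (rule o_Aut_0[OF induced_on_group_o_Aut])

lemma induced_on_group_add: "\<sigma> \<in> carrier V \<Longrightarrow>
    induced_on_group lt K \<sigma> (g + h) = induced_on_group lt K \<sigma> g + induced_on_group lt K \<sigma> h"
  using induced_on_group_o_Aut unfolding carrier_o_Aut by simp

text \<open>If the coefficient of \<open>a\<close> at \<open>g\<close> vanishes, then the value of \<open>a\<close> is larger than \<open>g\<close>, and so the
  value of \<open>\<sigma>(a)\<close> is larger than \<open>\<sigma>\<^sub>G(g)\<close>.\<close>

lemma
  assumes \<sigma>: "\<sigma> \<in> carrier V" and a: "a \<in> K" "a \<in> value_ge g"
  shows V_value_ge: "\<sigma> a \<in> value_ge (induced_on_group lt K \<sigma> g)"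
    and V_lowest_coeff_zero: "a g = 0 \<Longrightarrow> \<sigma> a (induced_on_group lt K \<sigma> g) = 0"
proof -
  let ?\<tau> = "induced_on_group lt K \<sigma>"
  have "\<sigma> a \<in> value_ge (?\<tau> g) \<and> (a g = 0 \<longrightarrow> \<sigma> a (?\<tau> g) = 0)"
  proof (cases "a = (\<lambda>g. 0)")
    case True
    then show ?thesis using V_zero[OF \<sigma>] by (simp add: value_ge_def)
  next
    case False
    have \<sigma>a: "\<sigma> a \<in> K" "\<sigma> a \<noteq> (\<lambda>g. 0)"
      using V_closed[OF \<sigma> a(1)] V_eq_zero_iff[OF \<sigma> a(1)] False by simp_all
    have least: "\<sigma> a h \<noteq> 0 \<Longrightarrow> h = ?\<tau> (val lt a) \<or> lt (?\<tau> (val lt a)) h" for h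
      using val_least(2)[OF \<sigma>a, of h] induced_on_group_val[OF \<sigma> a(1) False]
      by (auto simp: supp_def)
    have lt_\<tau>: "lt (?\<tau> g) (?\<tau> h) \<longleftrightarrow> lt g h" for g h
      using induced_on_group_o_Aut[OF \<sigma>] by (simp add: carrier_o_Aut)
    have va: "a (val lt a) \<noteq> 0"
      using val_least(1)[OF a(1) False] by (simp add: supp_def)
    then have "\<not> lt (val lt a) g" using a(2) by (auto simp: value_ge_def)
    then have "val lt a = g \<or> lt g (val lt a)" using lt_total by blast
    then have ge: "?\<tau> (val lt a) = ?\<tau> g \<or> lt (?\<tau> g) (?\<tau> (val lt a))"
      by (auto simp: lt_\<tau>)
    have "\<sigma> a h = 0" if "lt h (?\<tau> g)" for h
      using least[of h] that ge lt_trans lt_irrefl by metis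
    moreover have "\<sigma> a (?\<tau> g) = 0" if "a g = 0"
    proof (rule ccontr)
      assume nz: "\<sigma> a (?\<tau> g) \<noteq> 0"
      have "lt g (val lt a)" using va that \<open>val lt a = g \<or> lt g (val lt a)\<close> by auto
      then have "lt (?\<tau> g) (?\<tau> (val lt a))" by (simp add: lt_\<tau>)
      then show False using least[OF nz] lt_trans lt_irrefl by metis
    qed
    ultimately show ?thesis by (simp add: value_ge_def)
  qed
  then show "\<sigma> a \<in> value_ge (?\<tau> g)" "a g = 0 \<Longrightarrow> \<sigma> a (?\<tau> g) = 0" by simp_all
qed

lemma const_value_ge: "hahn_const c \<in> value_ge 0"
  using lt_irrefl by (auto simp: value_ge_def hahn_const_def)

lemma monomial_value_ge: "hahn_monomial g \<in> value_ge g"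
  using lt_irrefl by (auto simp: value_ge_def hahn_monomial_def)

text \<open>The formula that governs everything below. By \<open>V_lowest_coeff_zero\<close> the coefficient on
  the left depends only on \<open>a g\<close>, so that \<open>a\<close> may be replaced by the product of a constant
  and a monomial.\<close>

lemma lowest_coeff:
  assumes \<sigma>: "\<sigma> \<in> carrier V" and a: "a \<in> K" "a \<in> value_ge g"
  shows "\<sigma> a (induced_on_group lt K \<sigma> g) = induced_on_residue_field \<sigma> (a g) * twist \<sigma> g"
proof -
  let ?\<tau> = "induced_on_group lt K \<sigma>"
  define b where "b = hahn_const (a g) \<star> hahn_monomial g"
  have b_eq: "b = (\<lambda>h. if h = g then a g else 0)"
    unfolding b_def mult_const by (auto simp: hahn_monomial_def)
  have b: "b \<in> K" unfolding b_def by (intro mult_closed const_closed monomial_closed)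
  have "(\<lambda>h. a h - b h) \<in> value_ge g"
    using a(2) lt_irrefl by (auto simp: b_eq value_ge_def)
  then have "\<sigma> (\<lambda>h. a h - b h) (?\<tau> g) = 0"
    using V_lowest_coeff_zero[OF \<sigma> diff_closed[OF a(1) b]] by (simp add: b_eq)
  then have "\<sigma> a (?\<tau> g) = \<sigma> b (?\<tau> g)"
    by (simp add: V_diff[OF \<sigma> a(1) b])
  also have "\<dots> = (\<sigma> (hahn_const (a g)) \<star> \<sigma> (hahn_monomial g)) (?\<tau> 0 + ?\<tau> g)"
    unfolding b_def V_mult[OF \<sigma> const_closed monomial_closed]
    by (simp add: induced_on_group_0[OF \<sigma>])
  also have "\<dots> = \<sigma> (hahn_const (a g)) (?\<tau> 0) * \<sigma> (hahn_monomial g) (?\<tau> g)"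
    by (intro lowest_coeff_mult V_value_ge \<sigma> const_closed monomial_closed
        const_value_ge monomial_value_ge)
  finally show ?thesis
    by (simp add: twist_def induced_on_residue_field_def induced_on_group_0[OF \<sigma>])
qed

lemma twist_0: "\<sigma> \<in> carrier V \<Longrightarrow> twist \<sigma> 0 = 1"
  by (simp add: twist_def monomial_0 V_one induced_on_group_0) (simp add: hahn_const_def)

lemma twist_add:
  assumes "\<sigma> \<in> carrier V" shows "twist \<sigma> (g + h) = twist \<sigma> g * twist \<sigma> h"
  unfolding twist_def induced_on_group_add[OF assms] monomial_mult[symmetric]
    V_mult[OF assms monomial_closed monomial_closed]
  by (intro lowest_coeff_mult V_value_ge assms monomial_closed monomial_value_ge)

lemma residue_one: "\<sigma> \<in> carrier V \<Longrightarrow> induced_on_residue_field \<sigma> 1 = 1"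
  by (simp add: induced_on_residue_field_def V_one) (simp add: hahn_const_def)

lemma residue_add:
  assumes "\<sigma> \<in> carrier V"
  shows "induced_on_residue_field \<sigma> (c + d) =
    induced_on_residue_field \<sigma> c + induced_on_residue_field \<sigma> d"
proof -
  have "hahn_const (c + d) = (\<lambda>g::'g. hahn_const c g + hahn_const d g)"
    by (auto simp: hahn_const_def)
  then show ?thesis
    by (simp only: induced_on_residue_field_def V_add[OF assms const_closed const_closed])
qed

lemma residue_mult:
  assumes "\<sigma> \<in> carrier V"
  shows "induced_on_residue_field \<sigma> (c * d) =
    induced_on_residue_field \<sigma> c * induced_on_residue_field \<sigma> d"
proof -
  have "\<sigma> (hahn_const c) \<in> value_ge 0" for c
    using V_value_ge[OF assms const_closed const_value_ge, of c]
    by (simp add: induced_on_group_0[OF assms])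
  then have "(\<sigma> (hahn_const c) \<star> \<sigma> (hahn_const d)) (0 + 0) =
      \<sigma> (hahn_const c) 0 * \<sigma> (hahn_const d) 0"
    by (intro lowest_coeff_mult)
  then show ?thesis
    unfolding induced_on_residue_field_def const_mult[symmetric]
      V_mult[OF assms const_closed const_closed] by simp
qed

lemma induced_on_group_comp:
  assumes \<sigma>: "\<sigma> \<in> carrier V" "\<sigma>' \<in> carrier V"
  shows "induced_on_group lt K (\<sigma> \<otimes>\<^bsub>V\<^esub> \<sigma>') = induced_on_group lt K \<sigma> \<circ> induced_on_group lt K \<sigma>'"
proof (rule induced_on_group_eqI)
  show "induced_on_group lt K \<sigma> \<circ> induced_on_group lt K \<sigma>' \<in> carrier (o_Aut lt)"
    by (intro o_Aut_comp induced_on_group_o_Aut \<sigma>)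
  fix a assume a: "a \<in> K" "a \<noteq> (\<lambda>g. 0)"
  then have "\<sigma>' a \<in> K" "\<sigma>' a \<noteq> (\<lambda>g. 0)"
    using V_closed[OF \<sigma>(2) a(1)] V_eq_zero_iff[OF \<sigma>(2) a(1)] by simp_all
  then show "val lt ((\<sigma> \<otimes>\<^bsub>V\<^esub> \<sigma>') a) =
      (induced_on_group lt K \<sigma> \<circ> induced_on_group lt K \<sigma>') (val lt a)"
    using a by (simp add: V_comp[OF \<sigma>] induced_on_group_val \<sigma>)
qed

text \<open>The series \<open>\<sigma>'(c)\<close> need not be a constant, but only its constant term matters for the
  constant term of its image under \<open>\<sigma>\<close>.\<close>

lemma residue_comp:
  assumes \<sigma>: "\<sigma> \<in> carrier V" "\<sigma>' \<in> carrier V"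
  shows "induced_on_residue_field (\<sigma> \<otimes>\<^bsub>V\<^esub> \<sigma>') =
    induced_on_residue_field \<sigma> \<circ> induced_on_residue_field \<sigma>'"
proof
  fix c
  have "\<sigma>' (hahn_const c) \<in> value_ge 0"
    using V_value_ge[OF \<sigma>(2) const_closed const_value_ge, of c]
    by (simp add: induced_on_group_0[OF \<sigma>(2)])
  from lowest_coeff[OF \<sigma>(1) V_closed[OF \<sigma>(2) const_closed] this]
  show "induced_on_residue_field (\<sigma> \<otimes>\<^bsub>V\<^esub> \<sigma>') c =
      (induced_on_residue_field \<sigma> \<circ> induced_on_residue_field \<sigma>') c"
    by (simp add: V_comp[OF \<sigma> const_closed] induced_on_group_0[OF \<sigma>(1)] twist_0[OF \<sigma>(1)]
        induced_on_residue_field_def)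
qed

lemma twist_comp:
  assumes \<sigma>: "\<sigma> \<in> carrier V" "\<sigma>' \<in> carrier V"
  shows "twist (\<sigma> \<otimes>\<^bsub>V\<^esub> \<sigma>') g =
    induced_on_residue_field \<sigma> (twist \<sigma>' g) * twist \<sigma> (induced_on_group lt K \<sigma>' g)"
  using lowest_coeff[OF \<sigma>(1) V_closed[OF \<sigma>(2) monomial_closed]
      V_value_ge[OF \<sigma>(2) monomial_closed monomial_value_ge], of g]
  by (simp add: twist_def V_comp[OF \<sigma> monomial_closed] induced_on_group_comp[OF \<sigma>])

lemma
  shows induced_on_group_one: "induced_on_group lt K \<one>\<^bsub>V\<^esub> = id"
    and residue_id: "induced_on_residue_field \<one>\<^bsub>V\<^esub> = id"
    and twist_one: "twist \<one>\<^bsub>V\<^esub> g = 1"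
proof -
  show "induced_on_group lt K \<one>\<^bsub>V\<^esub> = id"
    by (rule induced_on_group_eqI) (simp_all add: one_V carrier_o_Aut)
  then show "twist \<one>\<^bsub>V\<^esub> g = 1"
    by (simp add: twist_def one_V monomial_closed) (simp add: hahn_monomial_def)
  show "induced_on_residue_field \<one>\<^bsub>V\<^esub> = id"
    by (rule ext) (simp add: induced_on_residue_field_def one_V const_closed, simp add: hahn_const_def)
qed

lemma
  assumes \<sigma>: "\<sigma> \<in> carrier V"
  shows induced_on_group_inv: "induced_on_group lt K \<sigma> \<circ> induced_on_group lt K (inv\<^bsub>V\<^esub> \<sigma>) = id"
    and residue_inv: "induced_on_residue_field \<sigma> \<circ> induced_on_residue_field (inv\<^bsub>V\<^esub> \<sigma>) = id"
    and residue_inv': "induced_on_residue_field (inv\<^bsub>V\<^esub> \<sigma>) \<circ> induced_on_residue_field \<sigma> = id"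
  using \<sigma> induced_on_group_comp[of \<sigma> "inv\<^bsub>V\<^esub> \<sigma>"] residue_comp[of \<sigma> "inv\<^bsub>V\<^esub> \<sigma>"]
    residue_comp[of "inv\<^bsub>V\<^esub> \<sigma>" \<sigma>]
  by (simp_all add: induced_on_group_one residue_id)

lemma residue_field_Aut:
  assumes "\<sigma> \<in> carrier V" shows "induced_on_residue_field \<sigma> \<in> carrier field_Aut"
  unfolding carrier_field_Aut
  using o_bij[OF residue_inv'[OF assms] residue_inv[OF assms]]
    residue_one[OF assms] residue_add[OF assms] residue_mult[OF assms] by simp

lemma Phi_closed: "\<sigma> \<in> carrier V \<Longrightarrow> Phi lt K \<sigma> \<in> carrier Aut_kG"
  by (simp add: Phi_def residue_field_Aut induced_on_group_o_Aut)


section \<open>Internal automorphisms and 1-automorphisms\<close>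

lemma one_field_Aut: "\<one>\<^bsub>field_Aut\<^esub> = id" and one_o_Aut: "\<one>\<^bsub>o_Aut lt\<^esub> = id"
  by (auto simp: field_Aut_def o_Aut_def BijGroup_def)

lemma Int_Aut_iff: "\<sigma> \<in> carrier (Int_Aut lt K) \<longleftrightarrow>
    \<sigma> \<in> carrier V \<and> induced_on_residue_field \<sigma> = id \<and> induced_on_group lt K \<sigma> = id"
  by (simp add: Int_Aut_def kernel_def Phi_def one_field_Aut one_o_Aut)

lemma one_Aut_iff: "\<sigma> \<in> carrier (one_Aut lt K) \<longleftrightarrow>
    \<sigma> \<in> carrier (Int_Aut lt K) \<and> (\<forall>g. twist \<sigma> g = 1)"
  by (auto simp: one_Aut_def twist_def Int_Aut_iff)

lemma Int_Aut_V: "\<sigma> \<in> carrier (Int_Aut lt K) \<Longrightarrow> \<sigma> \<in> carrier V"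
  by (simp add: Int_Aut_iff)

lemma one_Aut_V: "\<sigma> \<in> carrier (one_Aut lt K) \<Longrightarrow> \<sigma> \<in> carrier V"
  by (simp add: one_Aut_iff Int_Aut_iff)

lemma Int_Aut_mult: "\<sigma> \<in> carrier (Int_Aut lt K) \<Longrightarrow> \<sigma>' \<in> carrier (Int_Aut lt K) \<Longrightarrow>
    \<sigma> \<otimes>\<^bsub>V\<^esub> \<sigma>' \<in> carrier (Int_Aut lt K)"
  by (simp add: Int_Aut_iff residue_comp induced_on_group_comp)

lemma one_Aut_mult: "\<sigma> \<in> carrier (one_Aut lt K) \<Longrightarrow> \<sigma>' \<in> carrier (one_Aut lt K) \<Longrightarrow>
    \<sigma> \<otimes>\<^bsub>V\<^esub> \<sigma>' \<in> carrier (one_Aut lt K)"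
  by (simp add: one_Aut_iff Int_Aut_mult Int_Aut_V twist_comp) (simp add: Int_Aut_iff)

lemma Int_Aut_conj:
  assumes "n \<in> carrier (Int_Aut lt K)" and \<sigma>: "\<sigma> \<in> carrier V"
  shows "\<sigma> \<otimes>\<^bsub>V\<^esub> n \<otimes>\<^bsub>V\<^esub> inv\<^bsub>V\<^esub> \<sigma> \<in> carrier (Int_Aut lt K)"
  using assms by (simp add: Int_Aut_iff residue_comp induced_on_group_comp residue_inv
      induced_on_group_inv)

text \<open>The twists of \<open>\<sigma>\<close> and \<open>\<sigma>\<^sup>-\<^sup>1\<close> compose as if \<open>n\<close> were absent, because \<open>n\<close> acts trivially on
  lowest terms.\<close>

lemma one_Aut_conj:
  assumes n: "n \<in> carrier (one_Aut lt K)" and \<sigma>: "\<sigma> \<in> carrier V"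
  shows "\<sigma> \<otimes>\<^bsub>V\<^esub> n \<otimes>\<^bsub>V\<^esub> inv\<^bsub>V\<^esub> \<sigma> \<in> carrier (one_Aut lt K)"
proof -
  have nV: "n \<in> carrier V" and nres: "induced_on_residue_field n = id"
    and ngrp: "induced_on_group lt K n = id" and ntw: "twist n g = 1" for g
    using n by (simp_all add: one_Aut_iff Int_Aut_iff)
  have "twist (\<sigma> \<otimes>\<^bsub>V\<^esub> n \<otimes>\<^bsub>V\<^esub> inv\<^bsub>V\<^esub> \<sigma>) g = 1" for g
  proof -
    have "twist (\<sigma> \<otimes>\<^bsub>V\<^esub> n \<otimes>\<^bsub>V\<^esub> inv\<^bsub>V\<^esub> \<sigma>) g = twist (\<sigma> \<otimes>\<^bsub>V\<^esub> inv\<^bsub>V\<^esub> \<sigma>) g"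
      using \<sigma> nV by (simp only: twist_comp residue_comp V.m_closed V.inv_closed)
        (simp add: nres ntw ngrp residue_one)
    then show ?thesis using \<sigma> by (simp add: twist_one)
  qed
  then show ?thesis
    using Int_Aut_conj[OF _ \<sigma>] n by (simp add: one_Aut_iff)
qed

lemma Phi_Int_Aut_mult:
  assumes "n \<in> carrier (Int_Aut lt K)" "\<sigma> \<in> carrier V"
  shows "Phi lt K (n \<otimes>\<^bsub>V\<^esub> \<sigma>) = Phi lt K \<sigma>"
  using assms by (simp add: Int_Aut_iff Phi_def residue_comp induced_on_group_comp)

lemma Int_Aut_of_Phi_eq:
  assumes "\<sigma> \<in> carrier V" "\<sigma>' \<in> carrier V" "Phi lt K \<sigma> = Phi lt K \<sigma>'"
  shows "\<sigma> \<otimes>\<^bsub>V\<^esub> inv\<^bsub>V\<^esub> \<sigma>' \<in> carrier (Int_Aut lt K)"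
  using assms by (simp add: Int_Aut_iff Phi_def residue_comp induced_on_group_comp
      residue_inv induced_on_group_inv)

lemma twist_Hom_group:
  assumes "\<sigma> \<in> carrier V" shows "twist \<sigma> \<in> carrier Hom_group"
proof -
  have "twist \<sigma> g * twist \<sigma> (- g) = 1" for g
    using twist_add[OF assms, of g "- g"] twist_0[OF assms] by simp
  then show ?thesis
    unfolding carrier_Hom_group using twist_add[OF assms] by (metis mult_zero_left zero_neq_one)
qed

lemma Hom_group_inverse: "x \<in> carrier Hom_group \<Longrightarrow> (\<lambda>g::'g. inverse (x g :: 'k)) \<in> carrier Hom_group"
  unfolding carrier_Hom_group by simp

context
  assumes lifting: "canonical_second_lifting lt K"
begin

lemma rho_Int_Aut: "x \<in> carrier Hom_group \<Longrightarrow> rho K x \<in> carrier (Int_Aut lt K)"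
  using lifting by (auto simp: canonical_second_lifting_def hom_def)

lemma rho_mult: "x \<in> carrier Hom_group \<Longrightarrow> y \<in> carrier Hom_group \<Longrightarrow>
    rho K (\<lambda>g. x g * y g) = rho K x \<otimes>\<^bsub>V\<^esub> rho K y"
  using lifting by (simp add: canonical_second_lifting_def hom_def) (simp add: Hom_group_def Int_Aut_def)

lemma rho_one: "rho K (\<lambda>g. 1) = \<one>\<^bsub>V\<^esub>"
  by (simp add: rho_def one_V)

lemma twist_rho:
  assumes "x \<in> carrier Hom_group" shows "twist (rho K x) g = x g"
  using rho_Int_Aut[OF assms]
  by (simp add: Int_Aut_iff twist_def rho_def monomial_closed) (simp add: hahn_monomial_def)

lemma twist_mult_rho:
  assumes "n \<in> carrier (one_Aut lt K)" "x \<in> carrier Hom_group"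
  shows "twist (n \<otimes>\<^bsub>V\<^esub> rho K x) = x"
  using assms rho_Int_Aut[OF assms(2)]
  by (auto simp: one_Aut_iff Int_Aut_iff twist_comp twist_rho)

text \<open>The twist of \<open>\<sigma>\<close> is a character, and dividing by the corresponding \<open>\<rho>\<^sub>x\<close> removes it.\<close>

lemma Int_Aut_decomposition:
  assumes "\<sigma> \<in> carrier (Int_Aut lt K)"
  obtains x where "x \<in> carrier Hom_group"
    and "\<sigma> \<otimes>\<^bsub>V\<^esub> inv\<^bsub>V\<^esub> (rho K x) \<in> carrier (one_Aut lt K)"
proof
  let ?x = "twist \<sigma>" and ?y = "\<lambda>g. inverse (twist \<sigma> g)"
  have \<sigma>: "\<sigma> \<in> carrier V" using assms by (rule Int_Aut_V)
  show x: "?x \<in> carrier Hom_group" using \<sigma> by (rule twist_Hom_group)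
  then have y: "?y \<in> carrier Hom_group" by (rule Hom_group_inverse)
  have \<rho>: "rho K ?x \<in> carrier (Int_Aut lt K)" "rho K ?y \<in> carrier (Int_Aut lt K)"
    by (rule rho_Int_Aut[OF x] rho_Int_Aut[OF y])+
  have "rho K ?y \<otimes>\<^bsub>V\<^esub> rho K ?x = \<one>\<^bsub>V\<^esub>"
    unfolding rho_mult[OF y x, symmetric] rho_one[symmetric]
    using x by (simp add: carrier_Hom_group)
  then have inv: "inv\<^bsub>V\<^esub> (rho K ?x) = rho K ?y"
    using \<rho> by (intro V.inv_equality) (simp_all add: Int_Aut_V)
  have "twist (\<sigma> \<otimes>\<^bsub>V\<^esub> rho K ?y) g = 1" for g
    using assms \<rho> x by (simp add: twist_comp Int_Aut_V twist_rho[OF y])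
      (simp add: Int_Aut_iff carrier_Hom_group)
  then show "\<sigma> \<otimes>\<^bsub>V\<^esub> inv\<^bsub>V\<^esub> (rho K ?x) \<in> carrier (one_Aut lt K)"
    unfolding inv one_Aut_iff using Int_Aut_mult[OF assms \<rho>(2)] by simp
qed

text \<open>The decomposition for a subgroup \<open>B\<close> of \<open>v\<close>-\<open>Aut K\<close> that contains all \<open>\<rho>\<^sub>x\<close>: the
  first two factors make up \<open>IntAut K \<inter> B\<close>, which is normal in \<open>B\<close>, and \<open>H\<close> is a complement
  because \<open>\<Phi>\<close> maps its image bijectively onto \<open>\<Phi>(B)\<close>. The character group enters
  through an isomorphic copy \<open>T\<close>.\<close>

lemma iterated_semidirect_decomposition:
  fixes \<kappa> :: "'t \<Rightarrow> 'g \<Rightarrow> 'k" and T :: "('t, 'r) monoid_scheme" and H :: "('h, 's) monoid_scheme"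
  assumes \<kappa>: "\<kappa> \<in> iso T Hom_group"
    and T_closed: "\<And>x y. x \<in> carrier T \<Longrightarrow> y \<in> carrier T \<Longrightarrow> x \<otimes>\<^bsub>T\<^esub> y \<in> carrier T"
    and B: "subgroup B V" and rho_B: "\<And>x. x \<in> carrier Hom_group \<Longrightarrow> rho K x \<in> B"
    and j: "j \<in> hom H V" and j_B: "\<And>h. h \<in> carrier H \<Longrightarrow> j h \<in> B"
    and H_closed: "\<And>x y. x \<in> carrier H \<Longrightarrow> y \<in> carrier H \<Longrightarrow> x \<otimes>\<^bsub>H\<^esub> y \<in> carrier H"
    and Phi_inj: "inj_on (\<lambda>h. Phi lt K (j h)) (carrier H)"
    and Phi_surj: "\<And>\<sigma>. \<sigma> \<in> B \<Longrightarrow> \<exists>h\<in>carrier H. Phi lt K (j h) = Phi lt K \<sigma>"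
    and N: "N = V\<lparr>carrier := carrier (one_Aut lt K) \<inter> B\<rparr>"
  defines "M \<equiv> semidirect N T (conj_action V N (\<lambda>\<sigma>. \<sigma>) (\<lambda>x. rho K (\<kappa> x)))"
  shows "V\<lparr>carrier := B\<rparr> \<cong>
    semidirect M H (conj_action V M (\<lambda>(\<sigma>, x). \<sigma> \<otimes>\<^bsub>V\<^esub> rho K (\<kappa> x)) j)"
proof -
  interpret B: subgroup B V by fact
  let ?i = "\<lambda>(\<sigma>, x). \<sigma> \<otimes>\<^bsub>V\<^esub> rho K (\<kappa> x)"
  have B_V: "\<sigma> \<in> carrier V" if "\<sigma> \<in> B" for \<sigma> using that by (rule B.mem_carrier)
  have \<kappa>_Hom: "\<kappa> x \<in> carrier Hom_group" if "x \<in> carrier T" for x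
    using \<kappa> that by (auto simp: iso_def hom_def)
  have carrier_N: "\<sigma> \<in> carrier N \<longleftrightarrow> \<sigma> \<in> carrier (one_Aut lt K) \<and> \<sigma> \<in> B" for \<sigma>
    by (simp add: N)
  have mult_N: "x \<otimes>\<^bsub>N\<^esub> y = x \<otimes>\<^bsub>V\<^esub> y" for x y by (simp add: N)
  have i1: "(\<lambda>\<sigma>. \<sigma>) \<in> hom N V"
    by (rule homI) (simp_all add: carrier_N mult_N B_V)
  have \<theta>: "(\<lambda>x. rho K (\<kappa> x)) \<in> hom T V"
  proof (rule homI)
    fix x y assume xy: "x \<in> carrier T" "y \<in> carrier T"
    have "\<kappa> (x \<otimes>\<^bsub>T\<^esub> y) = (\<lambda>g. \<kappa> x g * \<kappa> y g)"
      using \<kappa> xy by (simp add: iso_def hom_def) (simp add: Hom_group_def)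
    then show "rho K (\<kappa> (x \<otimes>\<^bsub>T\<^esub> y)) = rho K (\<kappa> x) \<otimes>\<^bsub>V\<^esub> rho K (\<kappa> y)"
      using rho_mult[OF \<kappa>_Hom[OF xy(1)] \<kappa>_Hom[OF xy(2)]] by simp
  qed (intro Int_Aut_V rho_Int_Aut \<kappa>_Hom)
  have conj1: "rho K (\<kappa> x) \<otimes>\<^bsub>V\<^esub> n \<otimes>\<^bsub>V\<^esub> inv\<^bsub>V\<^esub> (rho K (\<kappa> x)) \<in> (\<lambda>\<sigma>. \<sigma>) ` carrier N"
    if "n \<in> carrier N" "x \<in> carrier T" for n x
  proof -
    have \<rho>: "rho K (\<kappa> x) \<in> B" by (rule rho_B[OF \<kappa>_Hom[OF that(2)]])
    have n: "n \<in> carrier (one_Aut lt K)" "n \<in> B" using that by (simp_all add: carrier_N)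
    have "rho K (\<kappa> x) \<otimes>\<^bsub>V\<^esub> n \<otimes>\<^bsub>V\<^esub> inv\<^bsub>V\<^esub> (rho K (\<kappa> x)) \<in> carrier N"
      unfolding carrier_N
      by (intro conjI one_Aut_conj B.m_closed B.m_inv_closed n \<rho> B_V)
    then show ?thesis by simp
  qed
  have retract1: "x = x'"
    if c: "n \<in> carrier N" "x \<in> carrier T" "n' \<in> carrier N" "x' \<in> carrier T"
      and eq: "n \<otimes>\<^bsub>V\<^esub> rho K (\<kappa> x) = n' \<otimes>\<^bsub>V\<^esub> rho K (\<kappa> x')" for n x n' x'
  proof -
    have "twist (n \<otimes>\<^bsub>V\<^esub> rho K (\<kappa> x)) = \<kappa> x" "twist (n' \<otimes>\<^bsub>V\<^esub> rho K (\<kappa> x')) = \<kappa> x'"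
      using c by (intro twist_mult_rho \<kappa>_Hom; simp add: carrier_N)+
    then have "\<kappa> x = \<kappa> x'" using eq by simp
    moreover have "inj_on \<kappa> (carrier T)" using \<kappa> by (simp add: iso_def bij_betw_def)
    ultimately show ?thesis using c by (simp add: inj_on_eq_iff)
  qed
  have N_closed: "n \<otimes>\<^bsub>N\<^esub> n' \<in> carrier N" if "n \<in> carrier N" "n' \<in> carrier N" for n n'
    using that by (simp add: carrier_N mult_N one_Aut_mult)
  have inner: "?i \<in> hom M V" "inj_on ?i (carrier M)"
    unfolding M_def
    by (rule internal_semidirect;
        fact group_V i1 inj_on_id2 \<theta> conj1 retract1 N_closed T_closed)+
  have M_closed: "m \<otimes>\<^bsub>M\<^esub> m' \<in> carrier M" if "m \<in> carrier M" "m' \<in> carrier M" for m m'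
    unfolding M_def
    by (rule internal_semidirect(3);
        fact group_V i1 inj_on_id2 \<theta> conj1 retract1 N_closed T_closed that[unfolded M_def])

  have image: "?i ` carrier M = carrier (Int_Aut lt K) \<inter> B"
  proof (intro equalityI subsetI)
    fix \<sigma> assume "\<sigma> \<in> ?i ` carrier M"
    then obtain n x where nx: "n \<in> carrier N" "x \<in> carrier T" "\<sigma> = n \<otimes>\<^bsub>V\<^esub> rho K (\<kappa> x)"
      unfolding M_def semidirect_def by auto
    then show "\<sigma> \<in> carrier (Int_Aut lt K) \<inter> B"
      by (simp add: Int_Aut_mult rho_Int_Aut rho_B \<kappa>_Hom carrier_N one_Aut_iff)
  next
    fix \<sigma> assume \<sigma>: "\<sigma> \<in> carrier (Int_Aut lt K) \<inter> B"
    then obtain y where y: "y \<in> carrier Hom_group"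
      "\<sigma> \<otimes>\<^bsub>V\<^esub> inv\<^bsub>V\<^esub> (rho K y) \<in> carrier (one_Aut lt K)"
      using Int_Aut_decomposition by blast
    from y(1) obtain x where x: "x \<in> carrier T" "y = \<kappa> x"
      using \<kappa> by (auto simp: iso_def bij_betw_def)
    have \<rho>: "rho K y \<in> B" by (rule rho_B[OF y(1)])
    have "\<sigma> \<otimes>\<^bsub>V\<^esub> inv\<^bsub>V\<^esub> (rho K y) \<in> carrier N"
      using \<sigma> \<rho> y(2) by (simp add: carrier_N)
    then have "(\<sigma> \<otimes>\<^bsub>V\<^esub> inv\<^bsub>V\<^esub> (rho K y), x) \<in> carrier M"
      using x by (simp add: M_def semidirect_def)
    moreover have "\<sigma> = ?i (\<sigma> \<otimes>\<^bsub>V\<^esub> inv\<^bsub>V\<^esub> (rho K y), x)"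
      using \<sigma> \<rho> x by (simp add: B_V V.m_assoc)
    ultimately show "\<sigma> \<in> ?i ` carrier M" by (rule rev_image_eqI)
  qed

  have i_Int: "?i m \<in> carrier (Int_Aut lt K)" "?i m \<in> B" if "m \<in> carrier M" for m
    using imageI[OF that, of ?i] unfolding image by simp_all
  have j_V: "j h \<in> carrier V" if "h \<in> carrier H" for h using j_B[OF that] by (rule B_V)
  have conj2: "j h \<otimes>\<^bsub>V\<^esub> ?i m \<otimes>\<^bsub>V\<^esub> inv\<^bsub>V\<^esub> (j h) \<in> ?i ` carrier M"
    if "m \<in> carrier M" "h \<in> carrier H" for m h
    unfolding image
    by (intro IntI Int_Aut_conj B.m_closed B.m_inv_closed i_Int j_B j_V that)
  have retract2: "h = h'"
    if c: "m \<in> carrier M" "h \<in> carrier H" "m' \<in> carrier M" "h' \<in> carrier H"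
      and eq: "?i m \<otimes>\<^bsub>V\<^esub> j h = ?i m' \<otimes>\<^bsub>V\<^esub> j h'" for m h m' h'
  proof -
    have "Phi lt K (j h) = Phi lt K (j h')"
      using Phi_Int_Aut_mult[OF i_Int(1)[OF c(1)] j_V[OF c(2)]]
        Phi_Int_Aut_mult[OF i_Int(1)[OF c(3)] j_V[OF c(4)]] eq by simp
    then show ?thesis using inj_onD[OF Phi_inj] c by blast
  qed
  let ?S = "semidirect M H (conj_action V M ?i j)"
  have outer: "(\<lambda>(m, h). ?i m \<otimes>\<^bsub>V\<^esub> j h) \<in> hom ?S V"
    "inj_on (\<lambda>(m, h). ?i m \<otimes>\<^bsub>V\<^esub> j h) (carrier ?S)"
    by (rule internal_semidirect;
        fact group_V inner j conj2 retract2 M_closed H_closed)+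
  have S_closed: "s \<otimes>\<^bsub>?S\<^esub> s' \<in> carrier ?S" if "s \<in> carrier ?S" "s' \<in> carrier ?S" for s s'
    by (rule internal_semidirect(3);
        fact group_V inner j conj2 retract2 M_closed H_closed that)

  show ?thesis
  proof (rule subgroup_iso_of_injective_hom)
    have carrier_S: "carrier ?S = carrier M \<times> carrier H" by (simp add: semidirect_def)
    show "(\<lambda>(m, h). ?i m \<otimes>\<^bsub>V\<^esub> j h) ` carrier ?S = B"
    proof (intro equalityI image_subsetI subsetI)
      fix p assume "p \<in> carrier ?S"
      then obtain m h where p: "p = (m, h)" and mh: "m \<in> carrier M" "h \<in> carrier H"
        unfolding carrier_S by (rule SigmaE)
      show "(\<lambda>(m, h). ?i m \<otimes>\<^bsub>V\<^esub> j h) p \<in> B"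
        unfolding p prod.case by (intro B.m_closed i_Int(2)[OF mh(1)] j_B[OF mh(2)])
    next
      fix \<sigma> assume \<sigma>: "\<sigma> \<in> B"
      then obtain h where h: "h \<in> carrier H" "Phi lt K (j h) = Phi lt K \<sigma>"
        using Phi_surj by blast
      have "\<sigma> \<otimes>\<^bsub>V\<^esub> inv\<^bsub>V\<^esub> (j h) \<in> carrier (Int_Aut lt K) \<inter> B"
        using Int_Aut_of_Phi_eq[OF B_V[OF \<sigma>] j_V[OF h(1)]] h \<sigma> j_B by simp
      then have "\<sigma> \<otimes>\<^bsub>V\<^esub> inv\<^bsub>V\<^esub> (j h) \<in> ?i ` carrier M" by (simp only: image)
      then obtain m where m: "\<sigma> \<otimes>\<^bsub>V\<^esub> inv\<^bsub>V\<^esub> (j h) = ?i m" "m \<in> carrier M" by (rule imageE)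
      have "\<sigma> = \<sigma> \<otimes>\<^bsub>V\<^esub> inv\<^bsub>V\<^esub> (j h) \<otimes>\<^bsub>V\<^esub> j h"
        using h \<sigma> by (simp add: V.m_assoc B_V j_V)
      then have "\<sigma> = ?i m \<otimes>\<^bsub>V\<^esub> j h" unfolding m(1) .
      then show "\<sigma> \<in> (\<lambda>(m, h). ?i m \<otimes>\<^bsub>V\<^esub> j h) ` carrier ?S"
        unfolding carrier_S using m h by (intro rev_image_eqI[of "(m, h)"]) simp_all
    qed
  qed (fact outer S_closed)+
qed

end


section \<open>Automorphisms that fix or stabilize the coefficient field\<close>

lemma carrier_fixing_k:
  "\<sigma> \<in> carrier (fixing_k A) \<longleftrightarrow> \<sigma> \<in> carrier A \<and> (\<forall>c. \<sigma> (hahn_const c) = hahn_const c)"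
  by (simp add: fixing_k_def)

lemma carrier_stabilizing_k: "\<sigma> \<in> carrier (stabilizing_k A) \<longleftrightarrow>
    \<sigma> \<in> carrier A \<and> \<sigma> ` range hahn_const = range hahn_const"
  by (simp add: stabilizing_k_def)

lemma V_inv_apply: "\<sigma> \<in> carrier V \<Longrightarrow> a \<in> K \<Longrightarrow> (inv\<^bsub>V\<^esub> \<sigma>) (\<sigma> a) = a"
  using V_comp[of "inv\<^bsub>V\<^esub> \<sigma>" \<sigma> a] by (simp add: one_V)

lemma subgroup_fixing_k: "subgroup (carrier (fixing_k V)) V"
proof (rule V.subgroupI)
  have "\<one>\<^bsub>V\<^esub> \<in> carrier (fixing_k V)"
    by (simp add: carrier_fixing_k) (simp add: one_V const_closed)
  then show "carrier (fixing_k V) \<noteq> {}" by blast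
  fix \<sigma> assume \<sigma>: "\<sigma> \<in> carrier (fixing_k V)"
  have "(inv\<^bsub>V\<^esub> \<sigma>) (hahn_const c) = hahn_const c" for c
    using \<sigma> V_inv_apply[of \<sigma> "hahn_const c"] by (simp add: carrier_fixing_k const_closed)
  then show "inv\<^bsub>V\<^esub> \<sigma> \<in> carrier (fixing_k V)"
    using \<sigma> by (simp add: carrier_fixing_k)
  fix \<sigma>' assume "\<sigma>' \<in> carrier (fixing_k V)"
  then show "\<sigma> \<otimes>\<^bsub>V\<^esub> \<sigma>' \<in> carrier (fixing_k V)"
    using \<sigma> by (simp add: carrier_fixing_k V_comp const_closed)
qed (simp add: carrier_fixing_k subset_eq)

lemma subgroup_stabilizing_k: "subgroup (carrier (stabilizing_k V)) V"
proof (rule V.subgroupI)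
  have "\<one>\<^bsub>V\<^esub> (hahn_const c) = hahn_const c" for c
    by (simp add: one_V const_closed)
  then have "\<one>\<^bsub>V\<^esub> ` range hahn_const = range hahn_const" by (simp add: image_image)
  then have "\<one>\<^bsub>V\<^esub> \<in> carrier (stabilizing_k V)"
    by (simp only: carrier_stabilizing_k V.one_closed)
  then show "carrier (stabilizing_k V) \<noteq> {}" by blast
  fix \<sigma> assume \<sigma>: "\<sigma> \<in> carrier (stabilizing_k V)"
  then have \<sigma>_V: "\<sigma> \<in> carrier V" and \<sigma>_k: "\<sigma> ` range hahn_const = range hahn_const"
    unfolding carrier_stabilizing_k by blast+
  have "(inv\<^bsub>V\<^esub> \<sigma>) ` \<sigma> ` range hahn_const = range hahn_const"
    by (simp add: image_image V_inv_apply \<sigma>_V const_closed)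
  then have "(inv\<^bsub>V\<^esub> \<sigma>) ` range hahn_const = range hahn_const" by (simp only: \<sigma>_k)
  then show "inv\<^bsub>V\<^esub> \<sigma> \<in> carrier (stabilizing_k V)"
    by (simp only: carrier_stabilizing_k V.inv_closed \<sigma>_V)
  fix \<sigma>' assume \<sigma>': "\<sigma>' \<in> carrier (stabilizing_k V)"
  then have \<sigma>'_V: "\<sigma>' \<in> carrier V" and \<sigma>'_k: "\<sigma>' ` range hahn_const = range hahn_const"
    unfolding carrier_stabilizing_k by blast+
  have "(\<sigma> \<otimes>\<^bsub>V\<^esub> \<sigma>') ` range hahn_const = \<sigma> ` \<sigma>' ` range hahn_const"
    by (simp add: image_image V_comp \<sigma>_V \<sigma>'_V const_closed)
  then show "\<sigma> \<otimes>\<^bsub>V\<^esub> \<sigma>' \<in> carrier (stabilizing_k V)"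
    by (simp only: carrier_stabilizing_k V.m_closed \<sigma>_V \<sigma>'_V \<sigma>_k \<sigma>'_k)
qed (simp add: carrier_stabilizing_k subset_eq)

lemma residue_fixing_k: "\<sigma> \<in> carrier (fixing_k V) \<Longrightarrow> induced_on_residue_field \<sigma> = id"
  by (rule ext) (simp add: carrier_fixing_k induced_on_residue_field_def, simp add: hahn_const_def)

text \<open>A constant is determined by its constant term.\<close>

lemma fixing_k_of_stabilizing_k:
  assumes "\<sigma> ` range hahn_const \<subseteq> range hahn_const" "induced_on_residue_field \<sigma> = id"
  shows "\<sigma> (hahn_const c) = hahn_const c"
proof -
  obtain d where d: "\<sigma> (hahn_const c) = hahn_const d"
    using assms(1) by blast
  have "\<sigma> (hahn_const c) 0 = c"
    using fun_cong[OF assms(2), of c] by (simp add: induced_on_residue_field_def)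
  then have "d = c" by (simp add: d) (simp add: hahn_const_def)
  then show ?thesis using d by simp
qed

lemma one_Aut_stabilizing_k:
  "carrier (one_Aut lt K) \<inter> carrier (stabilizing_k V) = carrier (one_Aut lt K) \<inter> carrier (fixing_k V)"
proof (intro equalityI subsetI)
  fix \<sigma> assume "\<sigma> \<in> carrier (one_Aut lt K) \<inter> carrier (stabilizing_k V)"
  then show "\<sigma> \<in> carrier (one_Aut lt K) \<inter> carrier (fixing_k V)"
    using fixing_k_of_stabilizing_k[of \<sigma>]
    by (simp add: carrier_stabilizing_k carrier_fixing_k one_Aut_iff Int_Aut_iff)
next
  fix \<sigma> assume "\<sigma> \<in> carrier (one_Aut lt K) \<inter> carrier (fixing_k V)"
  then show "\<sigma> \<in> carrier (one_Aut lt K) \<inter> carrier (stabilizing_k V)"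
    by (simp add: carrier_stabilizing_k carrier_fixing_k image_image)
qed

lemma one_Aut_eq: "one_Aut lt K = V\<lparr>carrier := carrier (one_Aut lt K)\<rparr>"
  unfolding one_Aut_def by (rule carrier_update_carrier[symmetric])

lemma fixing_k_one_Aut_eq:
  "fixing_k (one_Aut lt K) = V\<lparr>carrier := carrier (one_Aut lt K) \<inter> carrier (fixing_k V)\<rparr>"
proof -
  have "carrier (one_Aut lt K) \<inter> carrier (fixing_k V) =
      {\<sigma> \<in> carrier (one_Aut lt K). \<forall>c. \<sigma> (hahn_const c) = hahn_const c}"
    using one_Aut_V by (auto simp: carrier_fixing_k)
  moreover have "(one_Aut lt K)\<lparr>carrier := B\<rparr> = V\<lparr>carrier := B\<rparr>" for B
    by (simp add: one_Aut_def)
  ultimately show ?thesis by (simp add: fixing_k_def)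
qed

lemma rho_fixing_k:
  assumes "canonical_second_lifting lt K" "x \<in> carrier Hom_group"
  shows "rho K x \<in> carrier (fixing_k V)"
proof -
  have "x 0 = x 0 * x 0" "x 0 \<noteq> 0"
    using assms(2) unfolding carrier_Hom_group by (metis add_0_left)+
  then have "rho K x (hahn_const c) = hahn_const c" for c
    using const_closed[of c] by (auto simp: rho_def hahn_const_def)
  then show ?thesis
    using Int_Aut_V[OF rho_Int_Aut[OF assms]] by (simp add: carrier_fixing_k)
qed


section \<open>The canonical section\<close>

text \<open>For an infinite index set both sums are \<open>0\<close> by convention. The formula then holds for the
  convolution of arbitrary series, whatever their supports.\<close>

lemma field_Aut_sum:
  assumes "\<rho> \<in> carrier field_Aut" shows "\<rho> (\<Sum>i\<in>I. f i) = (\<Sum>i\<in>I. \<rho> (f i))"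
  using assms field_Aut_0[OF assms]
  by (induction I rule: infinite_finite_induct) (simp_all add: carrier_field_Aut)

context
  fixes \<rho> :: "'k \<Rightarrow> 'k" and \<tau> :: "'g \<Rightarrow> 'g"
  assumes \<rho>: "\<rho> \<in> carrier field_Aut" and \<tau>: "\<tau> \<in> carrier (o_Aut lt)"
begin

lemma \<tau>_surj: obtains g where "h = \<tau> g"
  using \<tau> unfolding carrier_o_Aut by (metis bij_pointE)

lemma inv_\<tau>: "inv_into UNIV \<tau> (\<tau> g) = g"
  using \<tau> by (simp add: carrier_o_Aut bij_is_inj)

lemma \<tau>_eq_iff: "\<tau> g = \<tau> h \<longleftrightarrow> g = h"
  by (metis inv_\<tau>)

lemma \<rho>_eq_iff: "\<rho> c = \<rho> d \<longleftrightarrow> c = d"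
  using \<rho> by (simp add: carrier_field_Aut bij_is_inj inj_eq)

lemma \<rho>_eq_0_iff: "\<rho> c = 0 \<longleftrightarrow> c = 0"
  by (metis \<rho>_eq_iff field_Aut_0[OF \<rho>])

lemma \<tau>_diff: "\<tau> (g - h) = \<tau> g - \<tau> h"
  using \<tau> unfolding carrier_o_Aut by (metis diff_add_cancel eq_diff_eq)

lemma canonical_lift_apply: "canonical_lift \<rho> \<tau> a (\<tau> g) = \<rho> (a g)"
  by (simp add: canonical_lift_def inv_\<tau>)

lemma canonical_lift_eqI:
  assumes "\<And>g. b (\<tau> g) = \<rho> (a g)" shows "canonical_lift \<rho> \<tau> a = b"
proof
  fix h
  obtain g where "h = \<tau> g" by (rule \<tau>_surj)
  then show "canonical_lift \<rho> \<tau> a h = b h" using assms by (simp add: canonical_lift_apply)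
qed

lemma supp_canonical_lift: "\<tau> g \<in> supp (canonical_lift \<rho> \<tau> a) \<longleftrightarrow> g \<in> supp a"
  by (simp add: supp_def canonical_lift_apply \<rho>_eq_0_iff)

text \<open>The map \<open>\<tau>\<close> carries the index set of each convolution sum bijectively onto the index set of
  the corresponding sum for the images.\<close>

lemma canonical_lift_mult:
  "canonical_lift \<rho> \<tau> (a \<star> b) = canonical_lift \<rho> \<tau> a \<star> canonical_lift \<rho> \<tau> b"
proof (rule canonical_lift_eqI)
  fix g
  let ?L = "canonical_lift \<rho> \<tau>"
  let ?I = "{h. h \<in> supp a \<and> g - h \<in> supp b}"
  let ?J = "{h. h \<in> supp (?L a) \<and> \<tau> g - h \<in> supp (?L b)}"
  have "bij_betw \<tau> ?I ?J"
  proof (rule bij_betw_imageI)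
    show "inj_on \<tau> ?I" by (simp add: inj_on_def \<tau>_eq_iff)
    show "\<tau> ` ?I = ?J"
    proof (intro equalityI subsetI)
      fix h assume h: "h \<in> ?J"
      obtain f where "h = \<tau> f" by (rule \<tau>_surj)
      with h show "h \<in> \<tau> ` ?I" by (simp add: supp_canonical_lift flip: \<tau>_diff)
    next
      fix h assume "h \<in> \<tau> ` ?I"
      then show "h \<in> ?J" by (auto simp: supp_canonical_lift simp flip: \<tau>_diff)
    qed
  qed
  then have "(?L a \<star> ?L b) (\<tau> g) = (\<Sum>h\<in>?I. ?L a (\<tau> h) * ?L b (\<tau> g - \<tau> h))"
    unfolding mult_eq by (rule sum.reindex_bij_betw[symmetric])
  also have "\<dots> = \<rho> ((a \<star> b) g)"
    unfolding mult_eq field_Aut_sum[OF \<rho>] \<tau>_diff[symmetric] canonical_lift_apply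
    using \<rho> by (simp add: carrier_field_Aut)
  finally show "(?L a \<star> ?L b) (\<tau> g) = \<rho> ((a \<star> b) g)" .
qed

lemma canonical_lift_const: "canonical_lift \<rho> \<tau> (hahn_const c) = hahn_const (\<rho> c)"
  using \<tau>_eq_iff[of _ 0]
  by (intro canonical_lift_eqI) (simp add: hahn_const_def o_Aut_0[OF \<tau>] field_Aut_0[OF \<rho>])

lemma val_canonical_lift:
  assumes "a \<in> K" "a \<noteq> (\<lambda>g. 0)"
  shows "val lt (canonical_lift \<rho> \<tau> a) = \<tau> (val lt a)"
proof (rule val_eqI)
  show "\<tau> (val lt a) \<in> supp (canonical_lift \<rho> \<tau> a)"
    using val_least(1)[OF assms] by (simp add: supp_canonical_lift)
  fix h assume h: "h \<in> supp (canonical_lift \<rho> \<tau> a)" "h \<noteq> \<tau> (val lt a)"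
  obtain g where g: "h = \<tau> g" by (rule \<tau>_surj)
  then have "lt (val lt a) g"
    using h val_least(2)[OF assms, of g] by (auto simp: supp_canonical_lift)
  then show "lt (\<tau> (val lt a)) h" using \<tau> g by (simp add: carrier_o_Aut)
qed

context
  assumes lift_K: "canonical_lift \<rho> \<tau> ` K = K"
begin

lemma canonical_section_V: "canonical_section K (\<rho>, \<tau>) \<in> carrier V"
proof (rule V_I[OF _ _ _ _ \<tau>])
  let ?L = "canonical_lift \<rho> \<tau>"
  have L: "canonical_section K (\<rho>, \<tau>) a = ?L a" if "a \<in> K" for a
    using that by (simp add: canonical_section_def)
  have "inj_on ?L K"
  proof (rule inj_onI)
    fix a b assume "?L a = ?L b"
    then have "\<rho> (a g) = \<rho> (b g)" for g using canonical_lift_apply[of a g] canonical_lift_apply[of b g] by simp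
    then show "a = b" by (simp add: \<rho>_eq_iff fun_eq_iff)
  qed
  then show "canonical_section K (\<rho>, \<tau>) \<in> Bij K"
    using lift_K by (simp add: Bij_def bij_betw_def canonical_section_def)
  have add: "?L (\<lambda>g. a g + b g) = (\<lambda>g. ?L a g + ?L b g)" for a b
    using \<rho> by (intro canonical_lift_eqI) (simp add: canonical_lift_apply carrier_field_Aut)
  fix a b assume ab: "a \<in> K" "b \<in> K"
  show "canonical_section K (\<rho>, \<tau>) (\<lambda>g. a g + b g) =
      (\<lambda>g. canonical_section K (\<rho>, \<tau>) a g + canonical_section K (\<rho>, \<tau>) b g)"
    by (simp only: L ab add_closed add)
  show "canonical_section K (\<rho>, \<tau>) (a \<star> b) =
      canonical_section K (\<rho>, \<tau>) a \<star> canonical_section K (\<rho>, \<tau>) b"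
    by (simp only: L ab mult_closed canonical_lift_mult)
next
  show "canonical_section K (\<rho>, \<tau>) (hahn_const 1) = hahn_const 1"
    using \<rho> by (simp add: canonical_section_def const_closed canonical_lift_const carrier_field_Aut)
  show "val lt (canonical_section K (\<rho>, \<tau>) a) = \<tau> (val lt a)" if "a \<in> K" "a \<noteq> (\<lambda>g. 0)" for a
    using that by (simp add: canonical_section_def val_canonical_lift)
qed

lemma canonical_section_const: "canonical_section K (\<rho>, \<tau>) (hahn_const c) = hahn_const (\<rho> c)"
  by (simp add: canonical_section_def const_closed canonical_lift_const)

lemma Phi_canonical_section: "Phi lt K (canonical_section K (\<rho>, \<tau>)) = (\<rho>, \<tau>)"
proof -
  have "induced_on_group lt K (canonical_section K (\<rho>, \<tau>)) = \<tau>"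
    by (rule induced_on_group_eqI[OF \<tau>]) (simp add: canonical_section_def val_canonical_lift)
  moreover have "induced_on_residue_field (canonical_section K (\<rho>, \<tau>)) = \<rho>"
    by (rule ext) (simp add: induced_on_residue_field_def canonical_section_const, simp add: hahn_const_def)
  ultimately show ?thesis by (simp add: Phi_def)
qed

end

end

lemma canonical_lift_comp:
  fixes a :: "'g \<Rightarrow> 'k"
  assumes "\<rho> \<in> carrier field_Aut" "\<tau> \<in> carrier (o_Aut lt)"
    "\<rho>' \<in> carrier field_Aut" "\<tau>' \<in> carrier (o_Aut lt)"
  shows "canonical_lift (\<rho> \<circ> \<rho>') (\<tau> \<circ> \<tau>') a = canonical_lift \<rho> \<tau> (canonical_lift \<rho>' \<tau>' a)"
  by (intro canonical_lift_eqI field_Aut_comp o_Aut_comp assms)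
    (simp add: canonical_lift_apply[OF assms(1,2)] canonical_lift_apply[OF assms(3,4)])

lemma canonical_section_hom:
  assumes "canonical_first_lifting lt K"
  shows "canonical_section K \<in> hom Aut_kG V"
proof (rule homI)
  have K: "canonical_lift \<rho> \<tau> ` K = K" if "\<rho> \<in> carrier field_Aut" "\<tau> \<in> carrier (o_Aut lt)" for \<rho> \<tau>
    using assms that by (simp add: canonical_first_lifting_def)
  show V: "canonical_section K p \<in> carrier V" if "p \<in> carrier Aut_kG" for p
    using that by (cases p) (simp add: canonical_section_V K)
  fix p q assume "p \<in> carrier Aut_kG" "q \<in> carrier Aut_kG"
  then obtain \<rho> \<tau> \<rho>' \<tau>' where pq: "p = (\<rho>, \<tau>)" "q = (\<rho>', \<tau>')"
    and c: "\<rho> \<in> carrier field_Aut" "\<tau> \<in> carrier (o_Aut lt)"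
      "\<rho>' \<in> carrier field_Aut" "\<tau>' \<in> carrier (o_Aut lt)"
    by (cases p, cases q) simp
  have pq_mult: "p \<otimes>\<^bsub>Aut_kG\<^esub> q = (\<rho> \<circ> \<rho>', \<tau> \<circ> \<tau>')"
    using c by (simp add: pq mult_field_Aut mult_o_Aut)
  have p: "canonical_section K p \<in> carrier V" and q: "canonical_section K q \<in> carrier V"
    using c by (simp_all add: pq canonical_section_V K)
  show "canonical_section K (p \<otimes>\<^bsub>Aut_kG\<^esub> q) =
      canonical_section K p \<otimes>\<^bsub>V\<^esub> canonical_section K q"
  proof (rule V_eqI)
    show "canonical_section K (p \<otimes>\<^bsub>Aut_kG\<^esub> q) \<in> carrier V"
      unfolding pq_mult by (intro canonical_section_V field_Aut_comp o_Aut_comp c K)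
    show "canonical_section K p \<otimes>\<^bsub>V\<^esub> canonical_section K q \<in> carrier V"
      using p q by simp
    fix a assume a: "a \<in> K"
    then have "canonical_lift \<rho>' \<tau>' a \<in> K" using K[OF c(3,4)] by blast
    then show "canonical_section K (p \<otimes>\<^bsub>Aut_kG\<^esub> q) a =
        (canonical_section K p \<otimes>\<^bsub>V\<^esub> canonical_section K q) a"
      unfolding V_comp[OF p q a] pq_mult
      using a by (simp add: pq canonical_section_def canonical_lift_comp[OF c])
  qed
qed

lemma id_field_Aut: "(id :: 'k \<Rightarrow> 'k) \<in> carrier field_Aut"
  by (simp add: carrier_field_Aut)

lemma field_Aut_o_Aut_closed:
  assumes "p \<in> carrier Aut_kG" "q \<in> carrier Aut_kG"
  shows "p \<otimes>\<^bsub>Aut_kG\<^esub> q \<in> carrier Aut_kG"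
  using assms by (cases p, cases q) (simp add: mult_field_Aut mult_o_Aut field_Aut_comp o_Aut_comp)

lemma o_Aut_section_hom:
  assumes "\<Psi> \<in> hom Aut_kG V"
  shows "(\<lambda>\<tau>. \<Psi> (id, \<tau>)) \<in> hom (o_Aut lt) V"
proof (rule homI)
  fix \<tau> \<tau>' assume \<tau>: "\<tau> \<in> carrier (o_Aut lt)" "\<tau>' \<in> carrier (o_Aut lt)"
  have "\<Psi> ((id, \<tau>) \<otimes>\<^bsub>Aut_kG\<^esub> (id, \<tau>')) = \<Psi> (id, \<tau>) \<otimes>\<^bsub>V\<^esub> \<Psi> (id, \<tau>')"
    using assms \<tau> id_field_Aut by (auto simp: hom_def)
  then show "\<Psi> (id, \<tau> \<otimes>\<^bsub>o_Aut lt\<^esub> \<tau>') = \<Psi> (id, \<tau>) \<otimes>\<^bsub>V\<^esub> \<Psi> (id, \<tau>')"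
    by (simp add: mult_field_Aut id_field_Aut)
qed (use assms id_field_Aut in \<open>auto simp: hom_def\<close>)

end


section \<open>The torus as a character group\<close>

lemma carrier_unit_torus: "x \<in> carrier (unit_torus :: ('n::finite \<Rightarrow> 'k::field) monoid) \<longleftrightarrow> (\<forall>i. x i \<noteq> 0)"
  by (auto simp: unit_torus_def mult_group_def PiE_UNIV_domain)

lemma mult_unit_torus: "x \<otimes>\<^bsub>unit_torus\<^esub> y = (\<lambda>i. x i * y i)"
  by (auto simp: unit_torus_def mult_group_def)

lemma torus_character_axis: "torus_character x (axis i 1) = x i"
proof -
  have "(\<Prod>j\<in>UNIV. x j powi (axis i 1 $ j)) = (\<Prod>j\<in>UNIV. if j = i then x i else 1)"
    by (rule prod.cong) (auto simp: axis_def)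
  then show ?thesis by (simp add: torus_character_def)
qed

text \<open>Induction on \<open>m\<close> in both directions, as \<open>m\<close> may be negative.\<close>

lemma character_axis:
  fixes y :: "int ^ 'n::finite \<Rightarrow> 'k::field"
  assumes "y \<in> carrier Hom_group"
  shows "y (axis i m) = y (axis i 1) powi m"
proof -
  have y: "\<And>g. y g \<noteq> 0" "\<And>g h. y (g + h) = y g * y h"
    using assms by (simp_all add: carrier_Hom_group)
  have y0: "y 0 = 1" using y(2)[of 0 0] y(1)[of 0] by simp
  have step: "y (axis i (m + 1)) = y (axis i m) * y (axis i 1)" for m
  proof -
    have "axis i (m + 1) = axis i m + axis i 1" by (simp add: axis_def vec_eq_iff)
    then show ?thesis using y(2) by simp
  qed
  show ?thesis
  proof (induction m rule: int_induct[where k = 0])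
    case base
    have axis_0: "axis i (0::int) = 0" by (simp add: axis_def vec_eq_iff)
    show ?case by (simp add: axis_0 y0)
  next
    case (step1 m)
    then show ?case using step y(1) by (simp add: power_int_add)
  next
    case (step2 m)
    then show ?case using step[of "m - 1"] y(1) by (simp add: power_int_diff field_simps)
  qed
qed

text \<open>Every element of \<open>\<int>\<^sup>n\<close> is a sum of multiples of the standard basis vectors, so that a
  character is the product of its restrictions to the coordinate axes.\<close>

lemma torus_character_iso:
  "torus_character \<in> iso (unit_torus :: ('n::finite \<Rightarrow> 'k::field) monoid) Hom_group"
  unfolding iso_iff
proof (intro conjI)
  have closed: "torus_character x \<in> carrier Hom_group"
    if "x \<in> carrier (unit_torus :: ('n \<Rightarrow> 'k) monoid)" for x
    using that by (simp add: carrier_Hom_group carrier_unit_torus torus_character_def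
        power_int_add prod.distrib)
  then show "torus_character \<in> hom (unit_torus :: ('n \<Rightarrow> 'k) monoid) Hom_group"
    by (intro homI) (simp_all add: mult_unit_torus Hom_group_def torus_character_def
        power_int_mult_distrib prod.distrib)
  show "inj_on torus_character (carrier (unit_torus :: ('n \<Rightarrow> 'k) monoid))"
    by (rule inj_onI, rule ext) (metis torus_character_axis)
  show "torus_character ` carrier (unit_torus :: ('n \<Rightarrow> 'k) monoid) = carrier Hom_group"
  proof (intro equalityI subsetI)
    fix y :: "int ^ 'n \<Rightarrow> 'k" assume y: "y \<in> carrier Hom_group"
    then have y': "\<And>g. y g \<noteq> 0" "\<And>g h. y (g + h) = y g * y h"
      by (simp_all add: carrier_Hom_group)
    have y0: "y 0 = 1" using y'(2)[of 0 0] y'(1)[of 0] by simp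
    have sum: "y (\<Sum>i\<in>A. f i) = (\<Prod>i\<in>A. y (f i))" if "finite A" for A :: "'n set" and f
      using that by (induction A) (simp_all add: y0 y'(2))
    let ?x = "\<lambda>i. y (axis i 1)"
    have "y g = torus_character ?x g" for g
    proof -
      have "g = (\<Sum>i\<in>UNIV. axis i (g $ i))"
        by (simp add: vec_eq_iff axis_def)
      then have "y g = (\<Prod>i\<in>UNIV. y (axis i (g $ i)))"
        using sum[of UNIV "\<lambda>i. axis i (g $ i)"] by simp
      also have "\<dots> = torus_character ?x g"
        unfolding torus_character_def by (intro prod.cong refl character_axis y)
      finally show ?thesis .
    qed
    then have "y = torus_character ?x" by (rule ext)
    moreover have "?x \<in> carrier unit_torus" by (simp add: carrier_unit_torus y'(1))
    ultimately show "y \<in> torus_character ` carrier unit_torus" by (rule image_eqI)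
  qed (use closed in auto)
qed


section \<open>The decompositions\<close>

locale ordered_hahn_field_Z = ordered_hahn_field lt K
  for lt :: "int ^ 'n::finite \<Rightarrow> int ^ 'n \<Rightarrow> bool" and K :: "(int ^ 'n \<Rightarrow> 'k::field) set" +
  assumes lifting: "canonical_second_lifting lt K"
begin

lemma decomposition:
  assumes B: "subgroup B V" "carrier (fixing_k V) \<subseteq> B"
    and j: "j \<in> hom H V" "\<And>h. h \<in> carrier H \<Longrightarrow> j h \<in> B"
      "\<And>x y. x \<in> carrier H \<Longrightarrow> y \<in> carrier H \<Longrightarrow> x \<otimes>\<^bsub>H\<^esub> y \<in> carrier H"
      "inj_on (\<lambda>h. Phi lt K (j h)) (carrier H)"
      "\<And>\<sigma>. \<sigma> \<in> B \<Longrightarrow> \<exists>h\<in>carrier H. Phi lt K (j h) = Phi lt K \<sigma>"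
    and N: "N = V\<lparr>carrier := carrier (one_Aut lt K) \<inter> B\<rparr>"
  shows "V\<lparr>carrier := B\<rparr> \<cong> iterated_semidirect lt K N H j"
  unfolding iterated_semidirect_def semidirect_by_torus_def
proof (rule iterated_semidirect_decomposition[OF lifting torus_character_iso _ B(1) _ j N])
  show "x \<otimes>\<^bsub>unit_torus\<^esub> y \<in> carrier unit_torus"
    if "x \<in> carrier unit_torus" "y \<in> carrier unit_torus" for x y :: "'n \<Rightarrow> 'k"
    using that by (simp add: carrier_unit_torus mult_unit_torus)
  show "rho K x \<in> B" if "x \<in> carrier Hom_group" for x
    using rho_fixing_k[OF lifting that] B(2) by blast
qed

text \<open>An automorphism that fixes \<open>k\<close> pointwise has trivial residue map, so that a section over
  \<open>o\<close>-\<open>Aut G\<close> alone reaches its image under \<open>\<Phi>\<close>.\<close>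

lemma fixing_k_decomposition:
  assumes j: "j \<in> hom (o_Aut lt) V" "\<And>\<tau>. \<tau> \<in> carrier (o_Aut lt) \<Longrightarrow> j \<tau> \<in> carrier (fixing_k V)"
    and Phi: "\<And>\<tau>. \<tau> \<in> carrier (o_Aut lt) \<Longrightarrow> Phi lt K (j \<tau>) = (id, \<tau>)"
  shows "fixing_k V \<cong> iterated_semidirect lt K (fixing_k (one_Aut lt K)) (o_Aut lt) j"
proof -
  have "V\<lparr>carrier := carrier (fixing_k V)\<rparr> \<cong>
      iterated_semidirect lt K (fixing_k (one_Aut lt K)) (o_Aut lt) j"
  proof (rule decomposition[OF subgroup_fixing_k order_refl j])
    show "\<tau> \<otimes>\<^bsub>o_Aut lt\<^esub> \<tau>' \<in> carrier (o_Aut lt)"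
      if "\<tau> \<in> carrier (o_Aut lt)" "\<tau>' \<in> carrier (o_Aut lt)" for \<tau> \<tau>'
      using that by (simp add: mult_o_Aut o_Aut_comp)
    show "inj_on (\<lambda>\<tau>. Phi lt K (j \<tau>)) (carrier (o_Aut lt))"
      by (simp add: inj_on_def Phi)
    fix \<sigma> assume \<sigma>: "\<sigma> \<in> carrier (fixing_k V)"
    then have "\<sigma> \<in> carrier V" by (simp add: carrier_fixing_k)
    then have \<tau>: "induced_on_group lt K \<sigma> \<in> carrier (o_Aut lt)" by (rule induced_on_group_o_Aut)
    have "Phi lt K \<sigma> = (id, induced_on_group lt K \<sigma>)"
      using residue_fixing_k[OF \<sigma>] by (simp add: Phi_def)
    then show "\<exists>\<tau>\<in>carrier (o_Aut lt). Phi lt K (j \<tau>) = Phi lt K \<sigma>"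
      using Phi[OF \<tau>] \<tau> by (intro bexI[OF _ \<tau>]) simp
  qed (assumption | rule fixing_k_one_Aut_eq)+
  also have "V\<lparr>carrier := carrier (fixing_k V)\<rparr> = fixing_k V"
    unfolding fixing_k_def by (rule carrier_update_carrier)
  finally show ?thesis .
qed

lemma v_Aut_decomposition:
  assumes "first_lifting_section lt K \<Psi>"
  shows "V \<cong> iterated_semidirect lt K (one_Aut lt K) Aut_kG \<Psi>"
proof -
  have \<Psi>: "\<Psi> \<in> hom Aut_kG V"
    and Phi: "\<And>p. p \<in> carrier Aut_kG \<Longrightarrow> Phi lt K (\<Psi> p) = p"
    using assms unfolding first_lifting_section_def by blast+
  have "V\<lparr>carrier := carrier V\<rparr> \<cong>
      iterated_semidirect lt K (one_Aut lt K) Aut_kG \<Psi>"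
  proof (rule decomposition[OF V.subgroup_self _ \<Psi>])
    show "carrier (fixing_k V) \<subseteq> carrier V" using subgroup_fixing_k by (rule subgroup.subset)
    show "\<Psi> p \<in> carrier V" if "p \<in> carrier Aut_kG" for p
      using \<Psi> that by (rule hom_in_carrier)
    show "inj_on (\<lambda>p. Phi lt K (\<Psi> p)) (carrier Aut_kG)"
      using Phi by (simp only: inj_on_def) metis
    show "\<exists>p\<in>carrier Aut_kG. Phi lt K (\<Psi> p) = Phi lt K \<sigma>"
      if "\<sigma> \<in> carrier V" for \<sigma>
      by (intro bexI[of _ "Phi lt K \<sigma>"] Phi Phi_closed that)
    have "carrier (one_Aut lt K) \<inter> carrier V = carrier (one_Aut lt K)"
      using one_Aut_V by blast
    then show "one_Aut lt K = V\<lparr>carrier := carrier (one_Aut lt K) \<inter> carrier V\<rparr>"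
      using one_Aut_eq by simp
  qed (rule field_Aut_o_Aut_closed)
  then show ?thesis by simp
qed

context
  assumes canonical: "canonical_first_lifting lt K"
begin

lemma Phi_section: "p \<in> carrier Aut_kG \<Longrightarrow> Phi lt K (canonical_section K p) = p"
  using canonical by (cases p) (simp add: Phi_canonical_section canonical_first_lifting_def)

lemma section_const:
  assumes "\<rho> \<in> carrier field_Aut" "\<tau> \<in> carrier (o_Aut lt)"
  shows "canonical_section K (\<rho>, \<tau>) (hahn_const c) = hahn_const (\<rho> c)"
  using canonical_section_const[OF assms] canonical assms by (simp add: canonical_first_lifting_def)

lemma section_V: "p \<in> carrier Aut_kG \<Longrightarrow> canonical_section K p \<in> carrier V"
  by (rule hom_in_carrier[OF canonical_section_hom[OF canonical]])

lemma fixing_k_canonical_decomposition: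
  "fixing_k V \<cong> iterated_semidirect lt K (fixing_k (one_Aut lt K)) (o_Aut lt)
     (\<lambda>\<tau>. canonical_section K (id, \<tau>))"
proof (rule fixing_k_decomposition)
  show "(\<lambda>\<tau>. canonical_section K (id, \<tau>)) \<in> hom (o_Aut lt) V"
    by (rule o_Aut_section_hom[OF canonical_section_hom[OF canonical]])
  fix \<tau> assume "\<tau> \<in> carrier (o_Aut lt)"
  then show "canonical_section K (id, \<tau>) \<in> carrier (fixing_k V)"
    "Phi lt K (canonical_section K (id, \<tau>)) = (id, \<tau>)"
    using id_field_Aut
    by (simp_all add: carrier_fixing_k section_V section_const Phi_section)
qed

lemma stabilizing_k_decomposition:
  "stabilizing_k V \<cong> iterated_semidirect lt K (fixing_k (one_Aut lt K)) Aut_kG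
     (canonical_section K)"
proof -
  have "V\<lparr>carrier := carrier (stabilizing_k V)\<rparr> \<cong>
      iterated_semidirect lt K (fixing_k (one_Aut lt K)) Aut_kG
        (canonical_section K)"
  proof (rule decomposition[OF subgroup_stabilizing_k _ canonical_section_hom[OF canonical]])
    show "carrier (fixing_k V) \<subseteq> carrier (stabilizing_k V)"
      by (auto simp: carrier_fixing_k carrier_stabilizing_k image_image)
    fix p assume p: "p \<in> carrier Aut_kG"
    then obtain \<rho> \<tau> where \<rho>\<tau>: "p = (\<rho>, \<tau>)" "\<rho> \<in> carrier field_Aut" "\<tau> \<in> carrier (o_Aut lt)"
      by (cases p) simp
    have "range \<rho> = UNIV" using \<rho>\<tau>(2) by (simp add: carrier_field_Aut bij_is_surj)
    then have "hahn_const ` range \<rho> = range hahn_const" by simp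
    then have "canonical_section K p ` range hahn_const = range hahn_const"
      using \<rho>\<tau> by (simp add: image_image section_const)
    then show "canonical_section K p \<in> carrier (stabilizing_k V)"
      using section_V[OF p] by (simp only: carrier_stabilizing_k)
  next
    show "inj_on (\<lambda>p. Phi lt K (canonical_section K p)) (carrier Aut_kG)"
      using Phi_section by (simp only: inj_on_def) metis
    fix \<sigma> assume "\<sigma> \<in> carrier (stabilizing_k V)"
    then have "Phi lt K \<sigma> \<in> carrier Aut_kG"
      by (intro Phi_closed) (simp only: carrier_stabilizing_k)
    then show "\<exists>p\<in>carrier Aut_kG. Phi lt K (canonical_section K p) = Phi lt K \<sigma>"
      by (intro bexI[of _ "Phi lt K \<sigma>"] Phi_section)
  next
    show "fixing_k (one_Aut lt K) = V\<lparr>carrier := carrier (one_Aut lt K) \<inter> carrier (stabilizing_k V)\<rparr>"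
      unfolding one_Aut_stabilizing_k by (rule fixing_k_one_Aut_eq)
  qed (rule field_Aut_o_Aut_closed)
  also have "V\<lparr>carrier := carrier (stabilizing_k V)\<rparr> = stabilizing_k V"
    unfolding stabilizing_k_def by (rule carrier_update_carrier)
  finally show ?thesis .
qed

end

end

theorem theorem5p1p1:
  fixes lt :: "int ^ 'n::finite \<Rightarrow> int ^ 'n \<Rightarrow> bool"
    and K :: "(int ^ 'n \<Rightarrow> 'k::field) set"
    and \<Psi> :: "('k \<Rightarrow> 'k) \<times> (int ^ 'n \<Rightarrow> int ^ 'n) \<Rightarrow> ((int ^ 'n \<Rightarrow> 'k) \<Rightarrow> (int ^ 'n \<Rightarrow> 'k))"
  assumes "group_ordering lt"
    and "hahn_field lt K"
    and "first_lifting_section lt K \<Psi>"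
    and "canonical_second_lifting lt K"
  shows
    "v_Aut lt K \<cong>
       iterated_semidirect lt K (one_Aut lt K) (field_Aut \<times>\<times> o_Aut lt) \<Psi> \<and>
     ((\<lambda>\<tau>. \<Psi> (id, \<tau>)) \<in> iso (o_Aut lt) (fixing_k (Ext_Aut lt K \<Psi>)) \<longrightarrow>
       fixing_k (v_Aut lt K) \<cong>
         iterated_semidirect lt K (fixing_k (one_Aut lt K)) (o_Aut lt) (\<lambda>\<tau>. \<Psi> (id, \<tau>))) \<and>
     (canonical_first_lifting lt K \<longrightarrow>
       fixing_k (v_Aut lt K) \<cong>
         iterated_semidirect lt K (fixing_k (one_Aut lt K)) (o_Aut lt)
           (\<lambda>\<tau>. canonical_section K (id, \<tau>)) \<and>
       stabilizing_k (v_Aut lt K) \<cong>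
         iterated_semidirect lt K (fixing_k (one_Aut lt K)) (field_Aut \<times>\<times> o_Aut lt)
           (canonical_section K))"
proof -
  interpret ordered_hahn_field_Z lt K
    using assms(1,2,4) by unfold_locales
  have \<Psi>: "\<Psi> \<in> hom (field_Aut \<times>\<times> o_Aut lt) (v_Aut lt K)"
    and Phi: "\<And>p. p \<in> carrier (field_Aut \<times>\<times> o_Aut lt) \<Longrightarrow> Phi lt K (\<Psi> p) = p"
    using assms(3) unfolding first_lifting_section_def by blast+
  have "fixing_k (v_Aut lt K) \<cong>
      iterated_semidirect lt K (fixing_k (one_Aut lt K)) (o_Aut lt) (\<lambda>\<tau>. \<Psi> (id, \<tau>))"
    if iso: "(\<lambda>\<tau>. \<Psi> (id, \<tau>)) \<in> iso (o_Aut lt) (fixing_k (Ext_Aut lt K \<Psi>))"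
  proof (rule fixing_k_decomposition[OF o_Aut_section_hom[OF \<Psi>]])
    fix \<tau> assume \<tau>: "\<tau> \<in> carrier (o_Aut lt)"
    then have p: "(id :: 'k \<Rightarrow> 'k, \<tau>) \<in> carrier (field_Aut \<times>\<times> o_Aut lt)" by (simp add: id_field_Aut)
    have "\<Psi> (id, \<tau>) \<in> carrier (fixing_k (Ext_Aut lt K \<Psi>))"
      using iso \<tau> by (auto simp: iso_def hom_def)
    then show "\<Psi> (id, \<tau>) \<in> carrier (fixing_k (v_Aut lt K))"
      using hom_in_carrier[OF \<Psi> p] by (simp add: carrier_fixing_k)
    show "Phi lt K (\<Psi> (id, \<tau>)) = (id, \<tau>)" using p by (rule Phi)
  qed
  then show ?thesis
    by (intro conjI impI v_Aut_decomposition[OF assms(3)] fixing_k_canonical_decomposition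
        stabilizing_k_decomposition)
qed

end
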